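(* Let $\Omega\subset\mathbb{R}^2$ be a rectangle. Then for every $\sigma>0$ there is some constant $C_\Omega(\sigma)>0$ such that for all $n$, $$d_n(\sigma)\le C_\Omega(\sigma).$$
   Context: For $\sigma\ge 0$ consider the Robin problem $-\Delta f=\lambda f$ on $\Omega$, $\frac{\partial f}{\partial n}+\sigma f=0$ on $\partial\Omega$, where $\frac{\partial f}{\partial n}$ is the derivative in the direction of the outward normal ($\sigma=0$ is the Neumann problem). Let $\lambda_0^\sigma\le\lambda_1^\sigma\le\dots$ be its eigenvalues, repeated with multiplicity. The Robin–Neumann gaps are $d_n(\sigma):=\lambda_n^\sigma-\lambda_n^0$. *)

theory Defs
  imports "HOL-Analysis.Analysis" "HOL-Library.Function_Algebras"
begin

interpretation fun_vs: vector_space "\<lambda>(c::real) (f :: 'a \<Rightarrow> real) x. c * f x"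
  by unfold_locales (auto simp: algebra_simps)

text \<open>A rectangle in general position, as an open set: a corner \<open>p\<close>, two orthonormal side
  directions \<open>u\<close>, \<open>v\<close> and two positive side lengths \<open>a\<close>, \<open>b\<close>.\<close>

definition rectangle :: "(real^2) set \<Rightarrow> bool" where
  "rectangle \<Omega> \<longleftrightarrow> (\<exists>p u v a b. norm u = 1 \<and> norm v = 1 \<and> u \<bullet> v = 0 \<and> a > 0 \<and> b > 0 \<and>
     \<Omega> = {p + s *\<^sub>R u + t *\<^sub>R v | s t. 0 < s \<and> s < a \<and> 0 < t \<and> t < b})"

text \<open>The outward unit normal of a convex set, at those boundary points where it is unique; for a
  rectangle these are all boundary points except the four corners.\<close>

definition outward_normal :: "'a::euclidean_space set \<Rightarrow> 'a \<Rightarrow> 'a \<Rightarrow> bool" where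
  "outward_normal \<Omega> x \<nu> \<longleftrightarrow> x \<in> frontier \<Omega> \<and>
     (\<forall>w. norm w = 1 \<and> (\<forall>y\<in>\<Omega>. w \<bullet> (y - x) \<le> 0) \<longleftrightarrow> w = \<nu>)"

text \<open>Classical solutions of \<open>-\<Delta>f = \<mu>f\<close> in \<open>\<Omega>\<close>, \<open>\<partial>f/\<partial>n + \<sigma>f = 0\<close> on \<open>\<partial>\<Omega>\<close>, of class \<open>C\<^sup>2\<close> in \<open>\<Omega>\<close> and
  \<open>C\<^sup>1\<close> up to the boundary: \<open>g\<close> is the gradient, \<open>H\<close> the Hessian matrix, and the Laplacian
  is the trace of \<open>H\<close>. A function on the closure of \<open>\<Omega>\<close> is represented by its extension by \<open>0\<close>,
  so that equality and linear independence refer to the values on the closure only.\<close>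

definition robin_eigenspace :: "(real^'n) set \<Rightarrow> real \<Rightarrow> real \<Rightarrow> (real^'n \<Rightarrow> real) set" where
  "robin_eigenspace \<Omega> \<sigma> \<mu> = {f. (\<forall>x. x \<notin> closure \<Omega> \<longrightarrow> f x = 0) \<and>
     (\<exists>(g :: real^'n \<Rightarrow> real^'n) (H :: real^'n \<Rightarrow> real^'n^'n).
        continuous_on (closure \<Omega>) g \<and>
        (\<forall>x\<in>closure \<Omega>. (f has_derivative (\<lambda>h. g x \<bullet> h)) (at x within closure \<Omega>)) \<and>
        continuous_on \<Omega> H \<and>
        (\<forall>x\<in>\<Omega>. (g has_derivative (\<lambda>h. H x *v h)) (at x)) \<and>
        (\<forall>x\<in>\<Omega>. - trace (H x) = \<mu> * f x) \<and>
        (\<forall>x \<nu>. outward_normal \<Omega> x \<nu> \<longrightarrow> g x \<bullet> \<nu> + \<sigma> * f x = 0))}"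

text \<open>The \<open>n\<close>-th eigenvalue (\<open>n \<ge> 0\<close>) in increasing order and repeated with multiplicity: the
  smallest \<open>t\<close> such that the eigenvalues \<open>\<le> t\<close> have total multiplicity greater than \<open>n\<close>.
  Lemma \<open>robin_eigenvalue_eq\<close> below shows agreement with any explicit enumeration.\<close>

definition robin_eigenvalue :: "(real^'n) set \<Rightarrow> real \<Rightarrow> nat \<Rightarrow> real" where
  "robin_eigenvalue \<Omega> \<sigma> n = Inf {t. \<exists>B. B \<subseteq> (\<Union>\<mu>\<in>{..t}. robin_eigenspace \<Omega> \<sigma> \<mu>) \<and>
     finite B \<and> fun_vs.independent B \<and> card B = Suc n}"

definition robin_neumann_gap :: "(real^'n) set \<Rightarrow> nat \<Rightarrow> real \<Rightarrow> real" where
  "robin_neumann_gap \<Omega> n \<sigma> = robin_eigenvalue \<Omega> \<sigma> n - robin_eigenvalue \<Omega> 0 n"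


lemma trace_scale: "trace (c *\<^sub>R M) = c * trace (M :: real^'n^'n)"
  by (simp add: trace_def sum_distrib_left)

lemma robin_eigenspace_subspace: "fun_vs.subspace (robin_eigenspace \<Omega> \<sigma> \<mu>)"
proof (rule fun_vs.subspaceI)
  show "0 \<in> robin_eigenspace \<Omega> \<sigma> \<mu>"
    unfolding robin_eigenspace_def
    by (auto intro!: exI[of _ "\<lambda>_. 0"] derivative_eq_intros simp: zero_fun_def trace_def)
next
  fix f f' assume "f \<in> robin_eigenspace \<Omega> \<sigma> \<mu>" "f' \<in> robin_eigenspace \<Omega> \<sigma> \<mu>"
  then obtain g H g' H' where "\<forall>x. x \<notin> closure \<Omega> \<longrightarrow> f x = 0" "\<forall>x. x \<notin> closure \<Omega> \<longrightarrow> f' x = 0"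
    and 1: "continuous_on (closure \<Omega>) g" "continuous_on (closure \<Omega>) g'"
    "\<forall>x\<in>closure \<Omega>. (f has_derivative (\<lambda>h. g x \<bullet> h)) (at x within closure \<Omega>)"
    "\<forall>x\<in>closure \<Omega>. (f' has_derivative (\<lambda>h. g' x \<bullet> h)) (at x within closure \<Omega>)"
    "continuous_on \<Omega> H" "continuous_on \<Omega> H'"
    "\<forall>x\<in>\<Omega>. (g has_derivative (\<lambda>h. H x *v h)) (at x)"
    "\<forall>x\<in>\<Omega>. (g' has_derivative (\<lambda>h. H' x *v h)) (at x)"
    "\<forall>x\<in>\<Omega>. - trace (H x) = \<mu> * f x" "\<forall>x\<in>\<Omega>. - trace (H' x) = \<mu> * f' x"
    "\<forall>x \<nu>. outward_normal \<Omega> x \<nu> \<longrightarrow> g x \<bullet> \<nu> + \<sigma> * f x = 0"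
    "\<forall>x \<nu>. outward_normal \<Omega> x \<nu> \<longrightarrow> g' x \<bullet> \<nu> + \<sigma> * f' x = 0"
    unfolding robin_eigenspace_def by blast
  then show "f + f' \<in> robin_eigenspace \<Omega> \<sigma> \<mu>"
    unfolding robin_eigenspace_def plus_fun_def
    apply (intro CollectI conjI exI[of _ "\<lambda>x. g x + g' x"] exI[of _ "\<lambda>x. H x + H' x"])
          apply (auto intro!: continuous_intros)
       apply (auto intro!: derivative_eq_intros simp: inner_add_left matrix_vector_mult_add_rdistrib)
     apply (force simp: trace_add algebra_simps)
    by (smt (verit) distrib_left)
next
  fix c f assume "f \<in> robin_eigenspace \<Omega> \<sigma> \<mu>"
  then obtain g H where "\<forall>x. x \<notin> closure \<Omega> \<longrightarrow> f x = 0"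
    and 1: "continuous_on (closure \<Omega>) g"
    "\<forall>x\<in>closure \<Omega>. (f has_derivative (\<lambda>h. g x \<bullet> h)) (at x within closure \<Omega>)"
    "continuous_on \<Omega> H"
    "\<forall>x\<in>\<Omega>. (g has_derivative (\<lambda>h. H x *v h)) (at x)"
    "\<forall>x\<in>\<Omega>. - trace (H x) = \<mu> * f x"
    "\<forall>x \<nu>. outward_normal \<Omega> x \<nu> \<longrightarrow> g x \<bullet> \<nu> + \<sigma> * f x = 0"
    unfolding robin_eigenspace_def by blast
  then show "(\<lambda>x. c * f x) \<in> robin_eigenspace \<Omega> \<sigma> \<mu>"
    unfolding robin_eigenspace_def
    apply (intro CollectI conjI exI[of _ "\<lambda>x. c *\<^sub>R g x"] exI[of _ "\<lambda>x. c *\<^sub>R H x"])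
          apply (auto intro!: continuous_intros)
       apply (auto intro!: derivative_eq_intros simp: scaleR_matrix_vector_assoc)
     apply (metis trace_scale mult.left_commute mult_minus_right)
    by (smt (verit) distrib_left mult.left_commute mult_zero_right)
qed

lemma robin_eigenfunctions_sum_eq_0:
  fixes \<Omega> :: "(real^'n) set"
  assumes "open \<Omega>" "finite M" "\<And>\<mu>. \<mu> \<in> M \<Longrightarrow> h \<mu> \<in> robin_eigenspace \<Omega> \<sigma> \<mu>"
    and "\<And>x. (\<Sum>\<mu>\<in>M. h \<mu> x) = 0"
  shows "(\<Sum>\<mu>\<in>M. \<mu> * h \<mu> x) = 0"
proof -
  have "\<forall>\<mu>\<in>M. \<exists>(g :: real^'n \<Rightarrow> real^'n) (H :: real^'n \<Rightarrow> real^'n^'n).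
      (\<forall>x. x \<notin> closure \<Omega> \<longrightarrow> h \<mu> x = 0) \<and>
      (\<forall>x\<in>closure \<Omega>. (h \<mu> has_derivative (\<lambda>k. g x \<bullet> k)) (at x within closure \<Omega>)) \<and>
      (\<forall>x\<in>\<Omega>. (g has_derivative (\<lambda>k. H x *v k)) (at x)) \<and>
      (\<forall>x\<in>\<Omega>. - trace (H x) = \<mu> * h \<mu> x)"
    using assms(3) unfolding robin_eigenspace_def by blast
  then obtain g where "\<forall>\<mu>\<in>M. \<exists>(H :: real^'n \<Rightarrow> real^'n^'n).
      (\<forall>x. x \<notin> closure \<Omega> \<longrightarrow> h \<mu> x = 0) \<and>
      (\<forall>x\<in>closure \<Omega>. (h \<mu> has_derivative (\<lambda>k. g \<mu> x \<bullet> k)) (at x within closure \<Omega>)) \<and>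
      (\<forall>x\<in>\<Omega>. (g \<mu> has_derivative (\<lambda>k. H x *v k)) (at x)) \<and>
      (\<forall>x\<in>\<Omega>. - trace (H x) = \<mu> * h \<mu> x)"
    by (subst (asm) bchoice_iff) blast
  then obtain H where
    zero: "\<And>\<mu> x. \<mu> \<in> M \<Longrightarrow> x \<notin> closure \<Omega> \<Longrightarrow> h \<mu> x = 0" and
    dh: "\<And>\<mu> x. \<mu> \<in> M \<Longrightarrow> x \<in> closure \<Omega> \<Longrightarrow>
      (h \<mu> has_derivative (\<lambda>k. g \<mu> x \<bullet> k)) (at x within closure \<Omega>)" and
    dg: "\<And>\<mu> x. \<mu> \<in> M \<Longrightarrow> x \<in> \<Omega> \<Longrightarrow> (g \<mu> has_derivative (\<lambda>k. H \<mu> x *v k)) (at x)" and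
    tr: "\<And>\<mu> x. \<mu> \<in> M \<Longrightarrow> x \<in> \<Omega> \<Longrightarrow> - trace (H \<mu> x :: real^'n^'n) = \<mu> * h \<mu> x"
    by (subst (asm) bchoice_iff) blast
  have dh': "(h \<mu> has_derivative (\<lambda>k. g \<mu> x \<bullet> k)) (at x)" if "\<mu> \<in> M" "x \<in> \<Omega>" for \<mu> x
  proof -
    have "x \<in> closure \<Omega>" using that closure_subset by blast
    moreover have "at x within closure \<Omega> = at x"
      by (rule at_within_nhd[of _ \<Omega>]) (use that assms(1) closure_subset[of \<Omega>] in auto)
    ultimately show ?thesis using dh that by metis
  qed
  have g0: "(\<Sum>\<mu>\<in>M. g \<mu> x) = 0" if "x \<in> \<Omega>" for x
  proof -
    have "((\<lambda>x. \<Sum>\<mu>\<in>M. h \<mu> x) has_derivative (\<lambda>k. \<Sum>\<mu>\<in>M. g \<mu> x \<bullet> k)) (at x)"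
      by (intro has_derivative_sum dh' that)
    then have "((\<lambda>x. 0) has_derivative (\<lambda>k. (\<Sum>\<mu>\<in>M. g \<mu> x) \<bullet> k)) (at x)"
      using assms(4) by (simp add: inner_sum_left)
    from has_derivative_unique[OF this has_derivative_const]
    have "(\<Sum>\<mu>\<in>M. g \<mu> x) \<bullet> k = 0" for k by metis
    then show ?thesis by (metis inner_eq_zero_iff)
  qed
  have "(\<Sum>\<mu>\<in>M. H \<mu> x) = 0" if x: "x \<in> \<Omega>" for x
  proof -
    have "((\<lambda>x. \<Sum>\<mu>\<in>M. g \<mu> x) has_derivative (\<lambda>k. \<Sum>\<mu>\<in>M. H \<mu> x *v k)) (at x)"
      by (intro has_derivative_sum dg x)
    then have "((\<lambda>x. 0) has_derivative (\<lambda>k. \<Sum>\<mu>\<in>M. H \<mu> x *v k)) (at x)"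
      by (rule has_derivative_transform_within_open[OF _ assms(1) x]) (use g0 in auto)
    from has_derivative_unique[OF this has_derivative_const]
    have *: "(\<Sum>\<mu>\<in>M. H \<mu> x *v k) = 0" for k by metis
    have "(\<Sum>\<mu>\<in>M. H \<mu> x) *v k = (\<Sum>\<mu>\<in>M. H \<mu> x *v k)" for k
      using assms(2) by induction (auto simp: matrix_vector_mult_add_rdistrib)
    with * show ?thesis by (simp add: matrix_eq)
  qed
  moreover have "trace (\<Sum>\<mu>\<in>M. H \<mu> x) = (\<Sum>\<mu>\<in>M. trace (H \<mu> x))" for x
    using assms(2) by induction (auto simp: trace_add trace_0[unfolded mat_0])
  ultimately have "(\<Sum>\<mu>\<in>M. trace (H \<mu> x)) = 0" if "x \<in> \<Omega>" for x
    using that trace_0[where 'a=real, unfolded mat_0] by metis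
  then have int: "(\<Sum>\<mu>\<in>M. \<mu> * h \<mu> x) = 0" if "x \<in> \<Omega>" for x
    using that tr by (simp add: sum_negf flip: tr)
  show ?thesis
  proof (cases "x \<in> closure \<Omega>")
    case True
    have "continuous_on (closure \<Omega>) (\<lambda>x. \<Sum>\<mu>\<in>M. \<mu> * h \<mu> x)"
      by (intro continuous_intros) (meson dh continuous_on_eq_continuous_within has_derivative_continuous)
    from continuous_constant_on_closure[OF this int True] show ?thesis .
  qed (simp add: zero)
qed

lemma robin_eigenfunctions_sum_eq_0D:
  fixes \<Omega> :: "(real^'n) set"
  assumes "open \<Omega>" "finite M" "\<And>\<mu>. \<mu> \<in> M \<Longrightarrow> h \<mu> \<in> robin_eigenspace \<Omega> \<sigma> \<mu>"
    and "\<And>x. (\<Sum>\<mu>\<in>M. h \<mu> x) = 0" and "\<mu> \<in> M"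
  shows "h \<mu> x = 0"
  using assms(2-)
proof (induction M arbitrary: h \<mu> x rule: finite_induct)
  case (insert \<nu> M)
  have eq0: "(\<Sum>\<mu>\<in>M. (\<mu> - \<nu>) * h \<mu> y) = 0" for y
    using robin_eigenfunctions_sum_eq_0[OF assms(1) _ insert.prems(1,2), of y] insert.prems(2)[of y]
      insert.hyps
    by (simp add: algebra_simps sum_subtractf flip: sum_distrib_right sum_distrib_left)
       (metis add_eq_0_iff mult.commute mult_minus_right)
  have *: "h \<mu> y = 0" if "\<mu> \<in> M" for \<mu> y
  proof -
    have "(\<mu> - \<nu>) * h \<mu> y = 0"
      using insert.IH[of "\<lambda>\<mu> y. (\<mu> - \<nu>) * h \<mu> y", OF _ eq0 that]
        fun_vs.subspace_scale[OF robin_eigenspace_subspace insert.prems(1)] by blast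
    with that insert.hyps show ?thesis by auto
  qed
  moreover have "h \<nu> y = 0" for y
    using insert.prems(2)[of y] insert.hyps * by simp
  ultimately show ?case using insert.prems by blast
qed simp

lemma robin_eigenvalue_eq:
  fixes \<Omega> :: "(real^'n) set" and ev :: "nat \<Rightarrow> real"
  assumes "open \<Omega>" "mono ev"
    and mult: "\<And>\<mu>. \<exists>B. finite B \<and> fun_vs.independent B \<and> fun_vs.span B = robin_eigenspace \<Omega> \<sigma> \<mu> \<and>
      finite {k. ev k = \<mu>} \<and> card {k. ev k = \<mu>} = card B"
  shows "robin_eigenvalue \<Omega> \<sigma> n = ev n"
proof -
  obtain B where B: "\<And>\<mu>. finite (B \<mu>)" "\<And>\<mu>. fun_vs.independent (B \<mu>)"
    "\<And>\<mu>. fun_vs.span (B \<mu>) = robin_eigenspace \<Omega> \<sigma> \<mu>" "\<And>\<mu>. finite {k. ev k = \<mu>}"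
    "\<And>\<mu>. card {k. ev k = \<mu>} = card (B \<mu>)"
    using mult by metis
  have BE: "f \<in> robin_eigenspace \<Omega> \<sigma> \<mu>" if "f \<in> B \<mu>" for f \<mu>
    using that B(3) fun_vs.span_superset by blast
  have disj: "B \<mu> \<inter> B \<nu> = {}" if "\<mu> \<noteq> \<nu>" for \<mu> \<nu>
  proof (rule ccontr)
    assume "B \<mu> \<inter> B \<nu> \<noteq> {}"
    then obtain f where f: "f \<in> B \<mu>" "f \<in> B \<nu>" by blast
    have "(\<lambda>x. (-1) * f x) \<in> robin_eigenspace \<Omega> \<sigma> \<nu>"
      by (rule fun_vs.subspace_scale[OF robin_eigenspace_subspace BE[OF f(2)]])
    define h where "h = (\<lambda>\<kappa> x. if \<kappa> = \<mu> then f x else (-1) * f x)"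
    have "h \<kappa> \<in> robin_eigenspace \<Omega> \<sigma> \<kappa>" if "\<kappa> \<in> {\<mu>,\<nu>}" for \<kappa>
      using that \<open>\<mu> \<noteq> \<nu>\<close> BE[OF f(1)] \<open>(\<lambda>x. (-1) * f x) \<in> _\<close> by (auto simp: h_def)
    moreover have "(\<Sum>\<kappa>\<in>{\<mu>,\<nu>}. h \<kappa> x) = 0" for x
      using \<open>\<mu> \<noteq> \<nu>\<close> by (simp add: h_def)
    ultimately have "h \<mu> x = 0" for x
      using robin_eigenfunctions_sum_eq_0D[OF assms(1), of "{\<mu>,\<nu>}" h] by blast
    then have "f x = 0" for x by (simp add: h_def)
    then have "f = 0" by (simp add: fun_eq_iff)
    with f(1) B(2)[of \<mu>] show False using fun_vs.dependent_zero by blast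
  qed
  have fsum: "(\<Sum>i\<in>I. F i) x = (\<Sum>i\<in>I. F i x)" for I :: "real set" and F :: "real \<Rightarrow> real^'n \<Rightarrow> real" and x
    by (induction I rule: infinite_finite_induct) auto
  have indep: "fun_vs.independent (\<Union>\<mu>\<in>M. B \<mu>)" if M: "finite M" for M
  proof (rule fun_vs.independent_if_scalars_zero)
    fix c f assume *: "(\<Sum>f\<in>(\<Union>\<mu>\<in>M. B \<mu>). (\<lambda>x. c f * f x)) = 0" and "f \<in> (\<Union>\<mu>\<in>M. B \<mu>)"
    then obtain \<mu> where \<mu>: "\<mu> \<in> M" "f \<in> B \<mu>" by blast
    define h where "h = (\<lambda>\<mu>. \<Sum>f\<in>B \<mu>. (\<lambda>x. c f * f x))"
    have "h \<mu> \<in> robin_eigenspace \<Omega> \<sigma> \<mu>" for \<mu>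
      unfolding h_def
      by (intro fun_vs.subspace_sum[OF robin_eigenspace_subspace]
          fun_vs.subspace_scale[OF robin_eigenspace_subspace] BE)
    moreover have "(\<Sum>\<mu>\<in>M. h \<mu>) = 0"
      unfolding h_def *[symmetric] by (rule sum.UNION_disjoint[symmetric]) (use M B(1) disj in auto)
    then have "(\<Sum>\<mu>\<in>M. h \<mu> x) = 0" for x
      using fsum[of h M x] by (simp add: zero_fun_def)
    ultimately have "h \<mu> x = 0" for x
      using robin_eigenfunctions_sum_eq_0D[OF assms(1) M] \<mu>(1) by blast
    then have "(\<Sum>f\<in>B \<mu>. (\<lambda>x. c f * f x)) = 0" by (auto simp: h_def fun_eq_iff)
    from fun_vs.independentD[OF B(2,1) order_refl this \<mu>(2)] show "c f = 0" .
  qed (use M B(1) in auto)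
  have card: "card (\<Union>\<mu>\<in>M. B \<mu>) = card {k. ev k \<in> M}" if "finite M" for M
  proof -
    have "card (\<Union>\<mu>\<in>M. B \<mu>) = (\<Sum>\<mu>\<in>M. card (B \<mu>))"
      by (rule card_UN_disjoint) (use that B(1) disj in auto)
    also have "\<dots> = card (\<Union>\<mu>\<in>M. {k. ev k = \<mu>})"
      unfolding B(5)[symmetric] by (rule card_UN_disjoint[symmetric]) (use that B(4) in auto)
    also have "(\<Union>\<mu>\<in>M. {k. ev k = \<mu>}) = {k. ev k \<in> M}" by auto
    finally show ?thesis .
  qed
  have "{t. \<exists>A. A \<subseteq> (\<Union>\<mu>\<in>{..t}. robin_eigenspace \<Omega> \<sigma> \<mu>) \<and>
     finite A \<and> fun_vs.independent A \<and> card A = Suc n} = {ev n..}" (is "?S = _")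
  proof (intro equalityI subsetI)
    fix t assume "t \<in> {ev n..}"
    define M where "M = ev ` {..n}"
    have fin: "finite M" by (simp add: M_def)
    have "finite {k. ev k \<in> M}"
      by (rule finite_subset[OF _ finite_UN_I[OF fin B(4)]]) auto
    then have "card {..n} \<le> card {k. ev k \<in> M}"
      by (rule card_mono) (auto simp: M_def)
    then have "Suc n \<le> card (\<Union>\<mu>\<in>M. B \<mu>)" using card[OF fin] by simp
    then obtain A where A: "A \<subseteq> (\<Union>\<mu>\<in>M. B \<mu>)" "card A = Suc n" "finite A"
      by (metis obtain_subset_with_card_n)
    have "\<mu> \<le> t" if \<mu>: "\<mu> \<in> M" for \<mu>
    proof -
      obtain k where "k \<le> n" "\<mu> = ev k" using \<mu> by (auto simp: M_def)
      then show ?thesis using monoD[OF assms(2) \<open>k \<le> n\<close>] \<open>t \<in> _\<close> by simp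
    qed
    then have "(\<Union>\<mu>\<in>M. B \<mu>) \<subseteq> (\<Union>\<mu>\<in>{..t}. robin_eigenspace \<Omega> \<sigma> \<mu>)"
      by (intro UN_mono) (auto intro: BE)
    then have "A \<subseteq> (\<Union>\<mu>\<in>{..t}. robin_eigenspace \<Omega> \<sigma> \<mu>)" using A(1) by (rule order_trans[rotated])
    moreover have "fun_vs.independent A"
      by (rule fun_vs.independent_mono[OF indep[OF fin] A(1)])
    ultimately show "t \<in> ?S"
      using A(2,3) by (intro CollectI exI[of _ A] conjI)
  next
    fix t assume "t \<in> ?S"
    then obtain A where A: "A \<subseteq> (\<Union>\<mu>\<in>{..t}. robin_eigenspace \<Omega> \<sigma> \<mu>)" "finite A"
      "fun_vs.independent A" "card A = Suc n" by blast
    show "t \<in> {ev n..}"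
    proof (rule ccontr)
      assume "t \<notin> {ev n..}"
      then have lt: "{k. ev k \<le> t} \<subseteq> {..<n}"
        using monoD[OF assms(2), of n] by (force simp: not_le intro: leI)
      define M where "M = ev ` {k. ev k \<le> t}"
      have fin: "finite M" unfolding M_def using lt finite_subset by blast
      have "A \<subseteq> fun_vs.span (\<Union>\<mu>\<in>M. B \<mu>)"
      proof
        fix f assume "f \<in> A"
        then obtain \<mu> where \<mu>: "\<mu> \<le> t" "f \<in> fun_vs.span (B \<mu>)" using A(1) B(3) by blast
        show "f \<in> fun_vs.span (\<Union>\<mu>\<in>M. B \<mu>)"
        proof (cases "\<mu> \<in> M")
          case True
          then show ?thesis using \<mu>(2) fun_vs.span_mono[of "B \<mu>" "\<Union>\<mu>\<in>M. B \<mu>"] by blast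
        next
          case False
          then have "{k. ev k = \<mu>} = {}" using \<mu>(1) by (auto simp: M_def)
          then have "B \<mu> = {}" using B(1,5)[of \<mu>] by simp
          then show ?thesis using \<mu>(2) fun_vs.span_zero by simp
        qed
      qed
      then have "card A \<le> card (\<Union>\<mu>\<in>M. B \<mu>)"
        using fun_vs.independent_span_bound[OF _ A(3)] fin B(1) by blast
      also have "\<dots> = card {k. ev k \<in> M}" by (rule card[OF fin])
      also have "{k. ev k \<in> M} = {k. ev k \<le> t}" by (auto simp: M_def)
      also have "card {k. ev k \<le> t} \<le> card {..<n}" by (rule card_mono) (use lt in auto)
      finally show False using A(4) by simp
    qed
  qed
  then show ?thesis by (simp add: robin_eigenvalue_def)
qed

end

theory Submission
  imports Defs
begin

text \<open>Separation of variables reduces the problem to an interval of length \<open>a\<close>. There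
  \<open>cos (\<alpha> s - \<theta>)\<close> with \<open>\<theta> = arctan (\<sigma> / \<alpha>)\<close> satisfies the Robin condition at \<open>0\<close>, and by the
  symmetry of the interval it satisfies the one at \<open>a\<close> when \<open>\<alpha> a = 2 \<theta> + j \<pi>\<close>. The Neumann
  frequency is \<open>j \<pi> / a\<close>, so Robin exceeds Neumann by \<open>2 \<theta> / a\<close>, and \<open>\<theta> \<le> \<sigma> / \<alpha>\<close> because
  \<open>arctan x \<le> x\<close>. In the difference of the squares the factor \<open>\<alpha>\<close> cancels: it is at most
  \<open>4 \<sigma> / a\<close>, uniformly in \<open>j\<close> (\<open>frequency_sq_le\<close>). Adding both directions, the Robin eigenvalue of
  the product mode with indices \<open>(j, k)\<close> exceeds the Neumann eigenvalue with the same indices by at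
  most \<open>C = 4 \<sigma> / a + 4 \<sigma> / b\<close>.

  It remains to pass from the eigenvalues of the product modes to the ordered eigenvalues. Suppose
  that the Neumann eigenfunctions with eigenvalue \<open>\<le> t\<close> contain \<open>n + 1\<close> independent ones. Every
  Neumann eigenfunction is a finite combination of product modes with its own eigenvalue
  (\<open>neumann_eigenspace_subset_span\<close>), so at least \<open>n + 1\<close> pairs \<open>(j, k)\<close> have Neumann
  eigenvalue \<open>\<le> t\<close>. The Robin product modes of these pairs are independent and have eigenvalues
  \<open>\<le> t + C\<close>, so the \<open>n\<close>-th Robin eigenvalue is at most \<open>t + C\<close>. Completeness thus
  enters on the Neumann side, where the modes are products of cosines.

  Completeness for Neumann means that an eigenfunction is orthogonal to the product modes of every
  other eigenvalue (\<open>integral_eigenfunction_mult_mode2\<close>, by Green's identity) and that a continuous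
  function orthogonal to all products of cosines is zero (\<open>cos_modes_complete\<close>, by
  Stone-Weierstrass). The definition of an eigenfunction leaves its second derivatives uncontrolled near
  the boundary, so Green's identity rests on a divergence theorem for fields that are differentiable in
  the open rectangle only (\<open>integral_divergence_eq_0\<close>).

  The eigenvalues are defined as infima of sets of reals, hence a bound from above also needs
  these sets to be bounded below. This is the maximum principle: for \<open>\<sigma> > 0\<close> there are no
  negative eigenvalues (\<open>robin_eigenfunction_negative_eq_0\<close>).\<close>

section \<open>A divergence theorem on a rectangle\<close>

lemma mem_box_Pair: "(s, t) \<in> box (c, d) (a, b) \<longleftrightarrow> s \<in> box c a \<and> t \<in> box d b"
  by (auto simp: box_prod)

lemma integral_partial_fst:
  fixes X X' :: "real \<times> real \<Rightarrow> real"
  assumes "c \<le> a" "continuous_on (cbox (c, d) (a, b)) X'"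
    and "\<And>s t. c \<le> s \<Longrightarrow> s \<le> a \<Longrightarrow> d \<le> t \<Longrightarrow> t \<le> b \<Longrightarrow>
      ((\<lambda>s. X (s, t)) has_real_derivative X' (s, t)) (at s)"
  shows "integral (cbox (c, d) (a, b)) X' = integral {d..b} (\<lambda>t. X (a, t) - X (c, t))"
proof -
  have "integral (cbox (c, d) (a, b)) X' =
      integral (cbox c a) (\<lambda>s. integral (cbox d b) (\<lambda>t. X' (s, t)))"
    by (rule integral_prod_continuous[OF assms(2)])
  also have "\<dots> = integral (cbox d b) (\<lambda>t. integral (cbox c a) (\<lambda>s. X' (s, t)))"
    by (rule integral_swap_continuous) (use assms(2) in \<open>simp add: case_prod_unfold\<close>)
  also have "\<dots> = integral (cbox d b) (\<lambda>t. X (a, t) - X (c, t))"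
  proof (rule integral_cong)
    fix t assume t: "t \<in> cbox d b"
    have "((\<lambda>s. X' (s, t)) has_integral (X (a, t) - X (c, t))) {c..a}"
      by (rule fundamental_theorem_of_calculus[OF assms(1)])
        (use t assms(3) in \<open>auto simp flip: has_real_derivative_iff_has_vector_derivative
            intro: has_field_derivative_at_within\<close>)
    then show "integral (cbox c a) (\<lambda>s. X' (s, t)) = X (a, t) - X (c, t)"
      by (simp add: integral_unique)
  qed
  finally show ?thesis by simp
qed

lemma integral_partial_snd:
  fixes Y Y' :: "real \<times> real \<Rightarrow> real"
  assumes "d \<le> b" "continuous_on (cbox (c, d) (a, b)) Y'"
    and "\<And>s t. c \<le> s \<Longrightarrow> s \<le> a \<Longrightarrow> d \<le> t \<Longrightarrow> t \<le> b \<Longrightarrow>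
      ((\<lambda>t. Y (s, t)) has_real_derivative Y' (s, t)) (at t)"
  shows "integral (cbox (c, d) (a, b)) Y' = integral {c..a} (\<lambda>s. Y (s, b) - Y (s, d))"
proof -
  have "integral (cbox (c, d) (a, b)) Y' =
      integral (cbox c a) (\<lambda>s. integral (cbox d b) (\<lambda>t. Y' (s, t)))"
    by (rule integral_prod_continuous[OF assms(2)])
  also have "\<dots> = integral (cbox c a) (\<lambda>s. Y (s, b) - Y (s, d))"
  proof (rule integral_cong)
    fix s assume s: "s \<in> cbox c a"
    have "((\<lambda>t. Y' (s, t)) has_integral (Y (s, b) - Y (s, d))) {d..b}"
      by (rule fundamental_theorem_of_calculus[OF assms(1)])
        (use s assms(3) in \<open>auto simp flip: has_real_derivative_iff_has_vector_derivative
            intro: has_field_derivative_at_within\<close>)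
    then show "integral (cbox d b) (\<lambda>t. Y' (s, t)) = Y (s, b) - Y (s, d)"
      by (simp add: integral_unique)
  qed
  finally show ?thesis by simp
qed

lemma abs_integral_le:
  fixes f :: "real \<Rightarrow> real"
  assumes "c \<le> d" "B \<ge> 0" "\<And>x. x \<in> {c..d} \<Longrightarrow> \<bar>f x\<bar> \<le> B"
  shows "\<bar>integral {c..d} f\<bar> \<le> B * (d - c)"
proof (cases "f integrable_on {c..d}")
  case True
  then show ?thesis
    using integrable_bound[of B f c d] assms by simp
qed (use assms in \<open>simp add: not_integrable_integral\<close>)

text \<open>\<open>X'\<close> and \<open>Y'\<close> may be unbounded near the boundary; only their sum has a continuous extension \<open>Z\<close>.
  On a slightly smaller rectangle the integral of \<open>Z\<close> is the flux of \<open>(X, Y)\<close> through its boundary.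
  This flux is small by uniform continuity, since the normal components vanish on the boundary of
  the whole rectangle, and the integral of \<open>Z\<close> depends continuously on the rectangle.\<close>

lemma integral_divergence_eq_0:
  fixes X Y Z X' Y' :: "real \<times> real \<Rightarrow> real"
  assumes ab: "a > 0" "b > 0"
    and cont: "continuous_on (cbox (0, 0) (a, b)) X" "continuous_on (cbox (0, 0) (a, b)) Y"
      "continuous_on (cbox (0, 0) (a, b)) Z"
    and cont': "continuous_on (box (0, 0) (a, b)) X'" "continuous_on (box (0, 0) (a, b)) Y'"
    and der: "\<And>s t. 0 < s \<Longrightarrow> s < a \<Longrightarrow> 0 < t \<Longrightarrow> t < b \<Longrightarrow>
        ((\<lambda>s. X (s, t)) has_real_derivative X' (s, t)) (at s)"
      "\<And>s t. 0 < s \<Longrightarrow> s < a \<Longrightarrow> 0 < t \<Longrightarrow> t < b \<Longrightarrow>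
        ((\<lambda>t. Y (s, t)) has_real_derivative Y' (s, t)) (at t)"
    and Z: "\<And>s t. 0 < s \<Longrightarrow> s < a \<Longrightarrow> 0 < t \<Longrightarrow> t < b \<Longrightarrow> X' (s, t) + Y' (s, t) = Z (s, t)"
    and X0: "\<And>t. 0 \<le> t \<Longrightarrow> t \<le> b \<Longrightarrow> X (0, t) = 0 \<and> X (a, t) = 0"
    and Y0: "\<And>s. 0 \<le> s \<Longrightarrow> s \<le> a \<Longrightarrow> Y (s, 0) = 0 \<and> Y (s, b) = 0"
  shows "integral (cbox (0, 0) (a, b)) Z = 0"
proof -
  let ?R = "cbox (0, 0) (a, b)"
  have "\<bar>integral ?R Z\<bar> < \<eta> + (2 * \<eta> * b + 2 * \<eta> * a)" if \<eta>: "\<eta> > 0" for \<eta>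
  proof -
    have unif: "\<exists>d>0. \<forall>z\<in>?R. \<forall>z'\<in>?R. dist z' z < d \<longrightarrow> dist (h z') (h z) < \<eta>"
      if "continuous_on ?R h" for h :: "real \<times> real \<Rightarrow> real"
      using compact_uniformly_continuous[OF that compact_cbox] \<eta>
      unfolding uniformly_continuous_on_def by blast
    obtain dX where dX: "dX > 0"
        "\<And>z z'. z \<in> ?R \<Longrightarrow> z' \<in> ?R \<Longrightarrow> dist z' z < dX \<Longrightarrow> dist (X z') (X z) < \<eta>"
      using unif[OF cont(1)] by blast
    obtain dY where dY: "dY > 0"
        "\<And>z z'. z \<in> ?R \<Longrightarrow> z' \<in> ?R \<Longrightarrow> dist z' z < dY \<Longrightarrow> dist (Y z') (Y z) < \<eta>"
      using unif[OF cont(2)] by blast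
    have "(0, 0) \<in> ?R" "(a, b) \<in> ?R" using ab by auto
    from indefinite_integral_continuous[OF integrable_continuous[OF cont(3)] this \<eta>]
    obtain dZ where dZ: "dZ > 0" "\<And>c' d'. c' \<in> ?R \<Longrightarrow> d' \<in> ?R \<Longrightarrow> norm (c' - (0, 0)) \<le> dZ \<Longrightarrow>
        norm (d' - (a, b)) \<le> dZ \<Longrightarrow> norm (integral (cbox c' d') Z - integral ?R Z) < \<eta>"
      by blast
    \<comment> \<open>a margin that serves both moduli of continuity, the continuity of the integral and the size of the rectangle\<close>
    define \<epsilon> where "\<epsilon> = min (min (dX / 2) (dY / 2)) (min (dZ / 2) (min (a / 2) (b / 2)))"
    have \<epsilon>: "\<epsilon> > 0" "\<epsilon> < dX" "\<epsilon> < dY" "\<epsilon> \<le> dZ / 2" "\<epsilon> \<le> a / 2" "\<epsilon> \<le> b / 2"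
      using dX(1) dY(1) dZ(1) ab by (auto simp: \<epsilon>_def)
    let ?I = "cbox (\<epsilon>, \<epsilon>) (a - \<epsilon>, b - \<epsilon>)"
    have sub: "?I \<subseteq> box (0, 0) (a, b)" "?I \<subseteq> ?R" using \<epsilon> by (auto simp: mem_box_Pair)
    have norms: "norm ((\<epsilon>, \<epsilon>) :: real \<times> real) \<le> 2 * \<epsilon>"
      using norm_Pair_le[of \<epsilon> \<epsilon>] \<epsilon>(1) by simp
    have close: "norm (integral ?I Z - integral ?R Z) < \<eta>"
    proof (rule dZ(2))
      have "(a - \<epsilon>, b - \<epsilon>) - (a, b) = - (\<epsilon>, \<epsilon>)" by simp
      then show "norm ((a - \<epsilon>, b - \<epsilon>) - (a, b)) \<le> dZ"
        using norms \<epsilon>(4) by (metis norm_minus_cancel le_divide_eq_numeral1(1) mult.commute order_trans)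
    qed (use norms \<epsilon> in auto)
    have "integral ?I Z = integral ?I (\<lambda>z. X' z + Y' z)"
      by (rule integral_cong) (use Z sub in \<open>auto simp: mem_box_Pair\<close>)
    also have "\<dots> = integral ?I X' + integral ?I Y'"
      by (rule integral_add; rule integrable_continuous; rule continuous_on_subset[OF _ sub(1)]; fact)
    also have "integral ?I X' = integral {\<epsilon>..b - \<epsilon>} (\<lambda>t. X (a - \<epsilon>, t) - X (\<epsilon>, t))"
      by (rule integral_partial_fst)
        (use \<epsilon> der(1) continuous_on_subset[OF cont'(1) sub(1)] in auto)
    also have "integral ?I Y' = integral {\<epsilon>..a - \<epsilon>} (\<lambda>s. Y (s, b - \<epsilon>) - Y (s, \<epsilon>))"
      by (rule integral_partial_snd)
        (use \<epsilon> der(2) continuous_on_subset[OF cont'(2) sub(1)] in auto)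
    finally have eq: "integral ?I Z = integral {\<epsilon>..b - \<epsilon>} (\<lambda>t. X (a - \<epsilon>, t) - X (\<epsilon>, t)) +
        integral {\<epsilon>..a - \<epsilon>} (\<lambda>s. Y (s, b - \<epsilon>) - Y (s, \<epsilon>))" .
    have "\<bar>integral {\<epsilon>..b - \<epsilon>} (\<lambda>t. X (a - \<epsilon>, t) - X (\<epsilon>, t))\<bar> \<le> 2 * \<eta> * (b - \<epsilon> - \<epsilon>)"
    proof (rule abs_integral_le)
      fix t assume t: "t \<in> {\<epsilon>..b - \<epsilon>}"
      have "dist (X (a - \<epsilon>, t)) (X (a, t)) < \<eta>" "dist (X (\<epsilon>, t)) (X (0, t)) < \<eta>"
        by (rule dX(2); use t \<epsilon> in \<open>auto simp: dist_Pair_Pair dist_real_def\<close>)+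
      then show "\<bar>X (a - \<epsilon>, t) - X (\<epsilon>, t)\<bar> \<le> 2 * \<eta>"
        using X0[of t] t \<epsilon> by (auto simp: dist_real_def)
    qed (use \<epsilon> \<eta> in auto)
    also have "\<dots> \<le> 2 * \<eta> * b" using \<epsilon> \<eta> by (intro mult_left_mono) auto
    finally have 1: "\<bar>integral {\<epsilon>..b - \<epsilon>} (\<lambda>t. X (a - \<epsilon>, t) - X (\<epsilon>, t))\<bar> \<le> 2 * \<eta> * b" .
    have "\<bar>integral {\<epsilon>..a - \<epsilon>} (\<lambda>s. Y (s, b - \<epsilon>) - Y (s, \<epsilon>))\<bar> \<le> 2 * \<eta> * (a - \<epsilon> - \<epsilon>)"
    proof (rule abs_integral_le)
      fix s assume s: "s \<in> {\<epsilon>..a - \<epsilon>}"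
      have "dist (Y (s, b - \<epsilon>)) (Y (s, b)) < \<eta>" "dist (Y (s, \<epsilon>)) (Y (s, 0)) < \<eta>"
        by (rule dY(2); use s \<epsilon> in \<open>auto simp: dist_Pair_Pair dist_real_def\<close>)+
      then show "\<bar>Y (s, b - \<epsilon>) - Y (s, \<epsilon>)\<bar> \<le> 2 * \<eta>"
        using Y0[of s] s \<epsilon> by (auto simp: dist_real_def)
    qed (use \<epsilon> \<eta> in auto)
    also have "\<dots> \<le> 2 * \<eta> * a" using \<epsilon> \<eta> by (intro mult_left_mono) auto
    finally have 2: "\<bar>integral {\<epsilon>..a - \<epsilon>} (\<lambda>s. Y (s, b - \<epsilon>) - Y (s, \<epsilon>))\<bar> \<le> 2 * \<eta> * a" .
    show ?thesis using close 1 2 unfolding eq real_norm_def by linarith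
  qed
  then have small: "\<bar>integral ?R Z\<bar> < \<eta> * (1 + 2 * b + 2 * a)" if "\<eta> > 0" for \<eta>
    using that by (simp add: algebra_simps)
  show ?thesis
  proof (rule ccontr)
    assume "integral ?R Z \<noteq> 0"
    then show False
      using small[of "\<bar>integral ?R Z\<bar> / (1 + 2 * b + 2 * a)"] ab by simp
  qed
qed

section \<open>Completeness of products of cosines\<close>

text \<open>Integer frequencies make the family closed under the product formula for cosines without a
  distinction of the sign of a difference of frequencies.\<close>

definition cos_mode :: "real \<Rightarrow> real \<Rightarrow> int \<times> int \<Rightarrow> real \<times> real \<Rightarrow> real" where
  "cos_mode a b p z = cos (of_int (fst p) * (pi / a * fst z)) * cos (of_int (snd p) * (pi / b * snd z))"

lemma cos_mode_mult:
  "cos_mode a b (j, k) z * cos_mode a b (l, m) z =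
    (cos_mode a b (j + l, k + m) z + cos_mode a b (j + l, k - m) z +
     cos_mode a b (j - l, k + m) z + cos_mode a b (j - l, k - m) z) / 4"
  (is "?L = _")
proof -
  have *: "cos (of_int i * c) * cos (of_int i' * c) =
      (cos (of_int (i + i') * c) + cos (of_int (i - i') * c)) / 2" for i i' :: int and c :: real
    by (simp add: cos_add cos_diff algebra_simps)
  have foil: "(A + B) / 2 * ((C + D) / 2) = (A * C + A * D + B * C + B * D) / 4"
    for A B C D :: real
    by (simp add: field_simps)
  have "?L = (cos (of_int j * (pi / a * fst z)) * cos (of_int l * (pi / a * fst z))) *
      (cos (of_int k * (pi / b * snd z)) * cos (of_int m * (pi / b * snd z)))"
    by (simp only: cos_mode_def fst_conv snd_conv mult_ac)
  also have "\<dots> = ((cos (of_int (j + l) * (pi / a * fst z)) + cos (of_int (j - l) * (pi / a * fst z))) / 2) *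
      ((cos (of_int (k + m) * (pi / b * snd z)) + cos (of_int (k - m) * (pi / b * snd z))) / 2)"
    by (simp only: *)
  finally show ?thesis
    by (simp only: foil cos_mode_def fst_conv snd_conv)
qed

lemma continuous_on_cos_mode: "continuous_on S (cos_mode a b p)"
  unfolding cos_mode_def by (intro continuous_intros)

text \<open>The product formula makes the span an algebra, as Stone-Weierstrass requires.\<close>

lemma cos_modes_span_mult:
  assumes "f \<in> fun_vs.span (range (cos_mode a b))" "g \<in> fun_vs.span (range (cos_mode a b))"
  shows "(\<lambda>z. f z * g z) \<in> fun_vs.span (range (cos_mode a b))" (is "_ \<in> ?V")
proof -
  have plus: "(\<lambda>z. f z + g z) \<in> ?V" if "f \<in> ?V" "g \<in> ?V" for f g
    using fun_vs.span_add[OF that] by (simp add: plus_fun_def)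
  have mode: "(\<lambda>z. cos_mode a b p z * cos_mode a b q z) \<in> ?V" for p q
  proof (cases p; cases q)
    fix j k l m assume "p = (j, k)" "q = (l, m)"
    moreover have "(\<lambda>z. (1/4) * (cos_mode a b (j + l, k + m) z + cos_mode a b (j + l, k - m) z +
        cos_mode a b (j - l, k + m) z + cos_mode a b (j - l, k - m) z)) \<in> ?V"
      by (intro fun_vs.span_scale plus fun_vs.span_base) auto
    ultimately show ?thesis by (simp add: cos_mode_mult)
  qed
  have half: "(\<lambda>z. cos_mode a b p z * g z) \<in> ?V" if "g \<in> ?V" for p g
    using that
  proof (induction rule: fun_vs.span_induct_alt)
    case base
    show ?case using fun_vs.span_zero by (simp add: zero_fun_def)
  next
    case (step c x y)
    then obtain q where q: "x = cos_mode a b q" by blast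
    have "(\<lambda>z. c * (cos_mode a b p z * cos_mode a b q z) + cos_mode a b p z * y z) \<in> ?V"
      by (intro plus fun_vs.span_scale mode step)
    then show ?case by (simp add: q plus_fun_def algebra_simps)
  qed
  show ?thesis using assms(1)
  proof (induction rule: fun_vs.span_induct_alt)
    case base
    show ?case using fun_vs.span_zero by (simp add: zero_fun_def)
  next
    case (step c x y)
    then obtain q where q: "x = cos_mode a b q" by blast
    have "(\<lambda>z. c * (cos_mode a b q z * g z) + y z * g z) \<in> ?V"
      by (intro plus fun_vs.span_scale half assms step)
    then show ?case by (simp add: q plus_fun_def algebra_simps)
  qed
qed

lemma cos_mode_0: "cos_mode a b (0, 0) = (\<lambda>z. 1)"
  by (simp add: cos_mode_def fun_eq_iff)

lemma continuous_on_cos_modes_span: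
  assumes "f \<in> fun_vs.span (range (cos_mode a b))"
  shows "continuous_on S f"
  using assms
proof (induction rule: fun_vs.span_induct_alt)
  case base
  show ?case by (simp add: zero_fun_def)
next
  case (step c x y)
  then show ?case
    by (auto simp: plus_fun_def intro!: continuous_intros continuous_on_cos_mode)
qed

text \<open>Points are separated because \<open>cos\<close> is injective on \<open>[0, \<pi>]\<close>.\<close>

lemma cos_modes_dense:
  fixes W :: "real \<times> real \<Rightarrow> real"
  assumes ab: "a > 0" "b > 0" and W: "continuous_on (cbox (0, 0) (a, b)) W" and "e > 0"
  shows "\<exists>g\<in>fun_vs.span (range (cos_mode a b)). \<forall>z\<in>cbox (0, 0) (a, b). \<bar>W z - g z\<bar> < e"
proof -
  let ?V = "fun_vs.span (range (cos_mode a b))" and ?R = "cbox (0, 0) (a, b)"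
  interpret function_ring_on ?V ?R
  proof
    fix f g assume "f \<in> ?V" "g \<in> ?V"
    then show "(\<lambda>x. f x + g x) \<in> ?V" "(\<lambda>x. f x * g x) \<in> ?V"
      using fun_vs.span_add cos_modes_span_mult by (auto simp: plus_fun_def)
  next
    fix c :: real
    have "(\<lambda>z. c * cos_mode a b (0, 0) z) \<in> ?V"
      by (intro fun_vs.span_scale fun_vs.span_base) auto
    then show "(\<lambda>_. c) \<in> ?V" by (simp add: cos_mode_0)
  next
    fix z w :: "real \<times> real" assume zw: "z \<in> ?R" "w \<in> ?R" "z \<noteq> w"
    obtain s t where z: "z = (s, t)" by force
    obtain s' t' where w: "w = (s', t')" by force
    have inj: "x = y" if "cos (pi / c * x) = cos (pi / c * y)" "0 \<le> x" "x \<le> c" "0 \<le> y" "y \<le> c" "c > 0"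
      for x y c :: real
      using cos_inj_pi[of "pi / c * x" "pi / c * y"] that by (auto simp: field_simps)
    have "cos_mode a b (1, 0) z \<noteq> cos_mode a b (1, 0) w \<or> cos_mode a b (0, 1) z \<noteq> cos_mode a b (0, 1) w"
      using inj[of a s s'] inj[of b t t'] zw ab by (auto simp: z w cos_mode_def)
    then show "\<exists>f\<in>?V. f z \<noteq> f w" by (metis fun_vs.span_base rangeI)
  qed (auto intro: continuous_on_cos_modes_span)
  show ?thesis by (rule Stone_Weierstrass_basic[OF W \<open>e > 0\<close>])
qed

text \<open>\<open>W\<close> is orthogonal to the span and a uniform limit of members of the span, hence orthogonal to
  itself.\<close>

lemma cos_modes_complete:
  fixes W :: "real \<times> real \<Rightarrow> real"
  assumes ab: "a > 0" "b > 0" and W: "continuous_on (cbox (0, 0) (a, b)) W"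
    and ortho: "\<And>p. integral (cbox (0, 0) (a, b)) (\<lambda>z. W z * cos_mode a b p z) = 0"
    and z: "z \<in> cbox (0, 0) (a, b)"
  shows "W z = 0"
proof -
  let ?R = "cbox (0, 0) (a, b)"
  have "continuous_on ?R g \<and> integral ?R (\<lambda>z. W z * g z) = 0"
    if "g \<in> fun_vs.span (range (cos_mode a b))" for g
    using that
  proof (induction rule: fun_vs.span_induct_alt)
    case base
    show ?case by (simp add: zero_fun_def)
  next
    case (step c x y)
    then obtain q where q: "x = cos_mode a b q" by blast
    have "integral ?R (\<lambda>z. c * (W z * x z) + W z * y z) =
        integral ?R (\<lambda>z. c * (W z * x z)) + integral ?R (\<lambda>z. W z * y z)"
      unfolding q
      by (intro integral_add integrable_continuous continuous_intros W continuous_on_cos_mode)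
        (use step in auto)
    moreover have "continuous_on ?R (\<lambda>z. c * x z + y z)"
      unfolding q by (intro continuous_intros continuous_on_cos_mode) (use step in auto)
    ultimately show ?case
      using step(2) ortho[of q] by (simp add: q plus_fun_def algebra_simps)
  qed
  then have perp: "integral ?R (\<lambda>z. W z * g z) = 0"
    if "g \<in> fun_vs.span (range (cos_mode a b))" for g
    using that by blast
  have "bounded (W ` ?R)"
    by (intro compact_imp_bounded compact_continuous_image W compact_cbox)
  then obtain M where M: "M > 0" "\<And>z. z \<in> ?R \<Longrightarrow> \<bar>W z\<bar> \<le> M"
    by (auto simp: bounded_pos)
  have cW2: "continuous_on ?R (\<lambda>z. W z * W z)" by (intro continuous_intros W)
  have area: "measure lborel ?R = a * b" using ab by (simp add: content_Pair)
  have small: "\<bar>integral ?R (\<lambda>z. W z * W z)\<bar> \<le> e * (M * (a * b))" if e: "e > 0" for e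
  proof -
    obtain g where g: "g \<in> fun_vs.span (range (cos_mode a b))" "\<And>z. z \<in> ?R \<Longrightarrow> \<bar>W z - g z\<bar> < e"
      using cos_modes_dense[OF ab W e] by blast
    note cg = continuous_on_cos_modes_span[OF g(1)]
    have "integral ?R (\<lambda>z. W z * W z - W z * g z) =
        integral ?R (\<lambda>z. W z * W z) - integral ?R (\<lambda>z. W z * g z)"
      by (intro integral_diff integrable_continuous continuous_intros W cg)
    then have "integral ?R (\<lambda>z. W z * W z) = integral ?R (\<lambda>z. W z * W z - W z * g z)"
      using perp[OF g(1)] by simp
    also have "norm \<dots> \<le> (M * e) * measure lborel ?R"
    proof (rule integrable_bound)
      show "(\<lambda>z. W z * W z - W z * g z) integrable_on ?R"
        by (intro integrable_continuous continuous_intros W cg)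
      fix z assume "z \<in> ?R"
      then have "\<bar>W z\<bar> * \<bar>W z - g z\<bar> \<le> M * e"
        by (intro mult_mono) (use M g(2)[of z] e in auto)
      then show "norm (W z * W z - W z * g z) \<le> M * e"
        by (simp add: abs_mult right_diff_distrib flip: abs_mult)
    qed (use M e in auto)
    finally show ?thesis by (simp only: area real_norm_def mult_ac)
  qed
  have "integral ?R (\<lambda>z. W z * W z) = 0"
  proof (rule ccontr)
    assume "integral ?R (\<lambda>z. W z * W z) \<noteq> 0" (is "?I \<noteq> 0")
    have "M * (a * b) > 0" using M ab by simp
    then show False
      using small[of "\<bar>?I\<bar> / (2 * (M * (a * b)))"] \<open>?I \<noteq> 0\<close> M ab by simp
  qed
  moreover have "box (0, 0) (a, b) \<noteq> {}"
    using ab by (auto simp: box_prod box_eq_empty)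
  ultimately have "\<forall>z\<in>?R. W z * W z = 0"
    using integral_cbox_eq_0_iff[OF cW2] by auto
  then show ?thesis using z by simp
qed

section \<open>Robin modes on an interval\<close>

text \<open>For \<open>\<sigma> > 0\<close> the function \<open>\<alpha> a - 2 arctan (\<sigma> / \<alpha>)\<close> is non-positive at \<open>min \<sigma> (\<pi> / (2 a))\<close>, where
  the arctangent is at least \<open>\<pi> / 4\<close>, and exceeds \<open>j \<pi>\<close> at \<open>(j + 1) \<pi> / a\<close>. In the case
  \<open>\<sigma> = \<alpha> = 0\<close> the convention \<open>0 / 0 = 0\<close> gives the correct phase \<open>0\<close> of the constant Neumann mode.\<close>

lemma robin_frequency_exists:
  assumes "\<sigma> \<ge> 0" "a > 0"
  shows "\<exists>\<alpha>\<ge>0. \<alpha> * a = 2 * arctan (\<sigma> / \<alpha>) + real j * pi \<and> (\<alpha> = 0 \<longrightarrow> \<sigma> = 0)"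
proof (cases "\<sigma> = 0")
  case True
  then show ?thesis using assms by (intro exI[of _ "real j * pi / a"]) auto
next
  case False
  define h where "h = (\<lambda>\<alpha>. \<alpha> * a - 2 * arctan (\<sigma> / \<alpha>))"
  define l where "l = min \<sigma> (pi / (2 * a))"
  define r where "r = (real j + 1) * pi / a"
  have l: "l > 0" "l \<le> \<sigma>" "l * a \<le> pi / 2"
    using False assms by (auto simp: l_def min_def field_simps)
  have "h l \<le> real j * pi"
  proof -
    have "arctan 1 \<le> arctan (\<sigma> / l)" using l by (intro arctan_monotone') (simp add: field_simps)
    moreover have "0 \<le> real j * pi" by simp
    ultimately show ?thesis using l(3) unfolding h_def arctan_one by linarith
  qed
  moreover have "real j * pi \<le> h r"
    using arctan_ubound[of "\<sigma> / r"] assms by (simp add: h_def r_def field_simps)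
  moreover have "l \<le> r"
  proof -
    have "pi / (2 * a) \<le> r" using assms by (simp add: r_def field_simps)
    then show ?thesis by (simp add: l_def min_def)
  qed
  moreover have "continuous_on {l..r} h"
    unfolding h_def using l by (intro continuous_intros) auto
  ultimately obtain \<alpha> where "l \<le> \<alpha>" "\<alpha> \<le> r" "h \<alpha> = real j * pi"
    using IVT'[of h l "real j * pi" r] by blast
  then show ?thesis using l by (intro exI[of _ \<alpha>]) (auto simp: h_def)
qed

definition frequency :: "real \<Rightarrow> real \<Rightarrow> nat \<Rightarrow> real" where
  "frequency \<sigma> a j = (SOME \<alpha>. \<alpha> \<ge> 0 \<and> \<alpha> * a = 2 * arctan (\<sigma> / \<alpha>) + real j * pi \<and> (\<alpha> = 0 \<longrightarrow> \<sigma> = 0))"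

lemma
  assumes "\<sigma> \<ge> 0" "a > 0"
  shows frequency_nonneg: "frequency \<sigma> a j \<ge> 0"
    and frequency_eq: "frequency \<sigma> a j * a = 2 * arctan (\<sigma> / frequency \<sigma> a j) + real j * pi"
    and frequency_eq_0D: "frequency \<sigma> a j = 0 \<Longrightarrow> \<sigma> = 0"
  using someI_ex[OF robin_frequency_exists[OF assms, of j]]
  unfolding frequency_def[symmetric] by auto

text \<open>The frequency determines the phase, and both determine \<open>j\<close>.\<close>

lemma frequency_inj:
  assumes "\<sigma> \<ge> 0" "a > 0" "frequency \<sigma> a j = frequency \<sigma> a k"
  shows "j = k"
proof -
  have "real j * pi = real k * pi"
    using frequency_eq[OF assms(1,2), of j] frequency_eq[OF assms(1,2), of k] unfolding assms(3) by linarith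
  then show ?thesis by simp
qed

lemma frequency_neumann: "a > 0 \<Longrightarrow> frequency 0 a j = real j * pi / a"
  using frequency_eq[of 0 a j] by (simp add: field_simps)

text \<open>This is the reason for the uniform bound. With \<open>\<beta>\<close> the Neumann frequency,
  \<open>(\<alpha> - \<beta>) a = 2 arctan (\<sigma> / \<alpha>) \<le> 2 \<sigma> / \<alpha>\<close> decays like \<open>1 / \<alpha>\<close>, which compensates the factor
  \<open>\<alpha> + \<beta> \<le> 2 \<alpha>\<close> in \<open>\<alpha>\<^sup>2 - \<beta>\<^sup>2\<close>.\<close>

lemma frequency_sq_le:
  assumes "\<sigma> \<ge> 0" "a > 0"
  shows "(frequency \<sigma> a j)\<^sup>2 \<le> (frequency 0 a j)\<^sup>2 + 4 * \<sigma> / a"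
proof (cases "frequency \<sigma> a j = 0")
  case True
  then show ?thesis using assms by simp
next
  case False
  define \<alpha> where "\<alpha> = frequency \<sigma> a j"
  define \<beta> where "\<beta> = frequency 0 a j"
  have \<alpha>: "\<alpha> > 0" using False frequency_nonneg[OF assms, of j] by (simp add: \<alpha>_def)
  have "\<beta> * a = real j * pi" using frequency_eq[of 0 a j] assms by (simp add: \<beta>_def)
  then have eq: "(\<alpha> - \<beta>) * a = 2 * arctan (\<sigma> / \<alpha>)"
    using frequency_eq[OF assms, of j] by (simp add: \<alpha>_def[symmetric] left_diff_distrib)
  have pos: "0 \<le> arctan (\<sigma> / \<alpha>)" using assms \<alpha> by simp
  then have "(\<alpha> - \<beta>) * a \<ge> 0" using eq by simp
  then have "\<beta> \<le> \<alpha>" using assms by (simp add: zero_le_mult_iff)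
  have "(\<alpha> - \<beta>) * a \<le> 2 * (\<sigma> / \<alpha>)"
    unfolding eq using arctan_le_self[of "\<sigma> / \<alpha>"] assms \<alpha> by simp
  then have "(\<alpha> - \<beta>) * a * (\<alpha> + \<beta>) \<le> 2 * (\<sigma> / \<alpha>) * (2 * \<alpha>)"
    using \<open>\<beta> \<le> \<alpha>\<close> frequency_nonneg[of 0 a j] assms \<alpha>
    by - (rule mult_mono, auto simp: \<beta>_def)
  also have "\<dots> = 4 * \<sigma>" using \<alpha> by simp
  finally have "(\<alpha>\<^sup>2 - \<beta>\<^sup>2) * a \<le> 4 * \<sigma>" by (simp add: power2_eq_square algebra_simps)
  then have "\<alpha>\<^sup>2 - \<beta>\<^sup>2 \<le> 4 * \<sigma> / a" using assms by (simp add: field_simps)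
  then show ?thesis by (simp add: \<alpha>_def \<beta>_def)
qed

definition mode :: "real \<Rightarrow> real \<Rightarrow> nat \<Rightarrow> real \<Rightarrow> real" where
  "mode \<sigma> a j s = cos (frequency \<sigma> a j * s - arctan (\<sigma> / frequency \<sigma> a j))"

definition mode_deriv :: "real \<Rightarrow> real \<Rightarrow> nat \<Rightarrow> real \<Rightarrow> real" where
  "mode_deriv \<sigma> a j s = - frequency \<sigma> a j * sin (frequency \<sigma> a j * s - arctan (\<sigma> / frequency \<sigma> a j))"

lemma DERIV_mode: "(mode \<sigma> a j has_real_derivative mode_deriv \<sigma> a j s) (at s within S)"
  unfolding mode_def mode_deriv_def by (auto intro!: derivative_eq_intros)

lemma DERIV_mode_deriv:
  "(mode_deriv \<sigma> a j has_real_derivative - (frequency \<sigma> a j)\<^sup>2 * mode \<sigma> a j s) (at s within S)"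
  unfolding mode_def mode_deriv_def
  by (auto intro!: derivative_eq_intros simp: power2_eq_square)

lemma continuous_on_mode: "continuous_on S (mode \<sigma> a j)"
  unfolding mode_def by (intro continuous_intros)

lemma continuous_on_mode_deriv: "continuous_on S (mode_deriv \<sigma> a j)"
  unfolding mode_deriv_def by (intro continuous_intros)

lemma frequency_phase:
  assumes "\<sigma> \<ge> 0" "a > 0"
  shows "frequency \<sigma> a j * sin (arctan (\<sigma> / frequency \<sigma> a j)) = \<sigma> * cos (arctan (\<sigma> / frequency \<sigma> a j))"
  using frequency_eq_0D[OF assms, of j] by (cases "frequency \<sigma> a j = 0") (auto simp: sin_arctan cos_arctan)

lemma mode_robin_left:
  assumes "\<sigma> \<ge> 0" "a > 0"
  shows "mode_deriv \<sigma> a j 0 = \<sigma> * mode \<sigma> a j 0"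
  using frequency_phase[OF assms] by (simp add: mode_def mode_deriv_def)

text \<open>The phase at \<open>a\<close> is \<open>\<theta> + j \<pi>\<close> and the phase at \<open>0\<close> is \<open>- \<theta>\<close>: up to sign, the mode is symmetric
  about the midpoint of the interval.\<close>

lemma mode_robin_right:
  assumes "\<sigma> \<ge> 0" "a > 0"
  shows "mode_deriv \<sigma> a j a = - \<sigma> * mode \<sigma> a j a"
proof -
  define \<theta> where "\<theta> = arctan (\<sigma> / frequency \<sigma> a j)"
  have "frequency \<sigma> a j * a - \<theta> = \<theta> + real j * pi"
    using frequency_eq[OF assms] by (simp add: \<theta>_def)
  then have "mode_deriv \<sigma> a j a = - frequency \<sigma> a j * ((-1) ^ j * sin \<theta>)"
    "mode \<sigma> a j a = (-1) ^ j * cos \<theta>"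
    unfolding mode_def mode_deriv_def \<theta>_def[symmetric]
    by (simp_all add: sin_add cos_add)
  then show ?thesis using frequency_phase[OF assms, of j] by (simp add: \<theta>_def[symmetric])
qed

lemma mode_0_pos: "mode \<sigma> a j 0 > 0"
  by (simp add: mode_def cos_arctan add_pos_nonneg)

text \<open>Integrate the derivative of the Wronskian of two modes; the Robin conditions make the Wronskian
  vanish at both ends.\<close>

lemma integral_mode_mult_mode:
  assumes "\<sigma> \<ge> 0" "a > 0" "j \<noteq> k"
  shows "integral {0..a} (\<lambda>s. mode \<sigma> a j s * mode \<sigma> a k s) = 0"
proof -
  let ?w = "\<lambda>s. mode_deriv \<sigma> a j s * mode \<sigma> a k s - mode \<sigma> a j s * mode_deriv \<sigma> a k s"
  have "((\<lambda>s. ((frequency \<sigma> a k)\<^sup>2 - (frequency \<sigma> a j)\<^sup>2) * (mode \<sigma> a j s * mode \<sigma> a k s))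
      has_integral (?w a - ?w 0)) {0..a}"
  proof (rule fundamental_theorem_of_calculus)
    fix s
    have "(?w has_real_derivative
        ((frequency \<sigma> a k)\<^sup>2 - (frequency \<sigma> a j)\<^sup>2) * (mode \<sigma> a j s * mode \<sigma> a k s)) (at s within {0..a})"
      by (rule derivative_eq_intros DERIV_mode DERIV_mode_deriv refl)+ (simp add: algebra_simps)
    then show "(?w has_vector_derivative
        ((frequency \<sigma> a k)\<^sup>2 - (frequency \<sigma> a j)\<^sup>2) * (mode \<sigma> a j s * mode \<sigma> a k s)) (at s within {0..a})"
      by (simp add: has_real_derivative_iff_has_vector_derivative)
  qed (use assms in simp)
  also have "?w a - ?w 0 = 0"
    by (simp add: mode_robin_left mode_robin_right assms)
  finally have "((frequency \<sigma> a k)\<^sup>2 - (frequency \<sigma> a j)\<^sup>2) *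
      integral {0..a} (\<lambda>s. mode \<sigma> a j s * mode \<sigma> a k s) = 0"
    unfolding integral_mult_right[symmetric] by (rule integral_unique)
  moreover have "(frequency \<sigma> a k)\<^sup>2 \<noteq> (frequency \<sigma> a j)\<^sup>2"
    using frequency_inj[OF assms(1,2)] frequency_nonneg[OF assms(1,2)] assms(3)
    by (metis power2_eq_imp_eq)
  ultimately show ?thesis by simp
qed

section \<open>Products of modes\<close>

definition mode2 :: "real \<Rightarrow> real \<Rightarrow> real \<Rightarrow> nat \<times> nat \<Rightarrow> real \<times> real \<Rightarrow> real" where
  "mode2 \<sigma> a b q z = mode \<sigma> a (fst q) (fst z) * mode \<sigma> b (snd q) (snd z)"

lemma continuous_on_mode2: "continuous_on S (mode2 \<sigma> a b q)"
  unfolding mode2_def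
  by (intro continuous_intros continuous_on_compose2[OF continuous_on_mode]) auto

lemma integral_mode2_mult_mode2:
  assumes "\<sigma> \<ge> 0" "a > 0" "b > 0" "p \<noteq> q"
  shows "integral (cbox (0, 0) (a, b)) (\<lambda>z. mode2 \<sigma> a b p z * mode2 \<sigma> a b q z) = 0"
proof -
  obtain j k where p: "p = (j, k)" by force
  obtain l m where q: "q = (l, m)" by force
  have "integral (cbox (0, 0) (a, b)) (\<lambda>z. mode2 \<sigma> a b p z * mode2 \<sigma> a b q z) =
      integral (cbox 0 a) (\<lambda>s. integral (cbox 0 b) (\<lambda>t.
        mode2 \<sigma> a b p (s, t) * mode2 \<sigma> a b q (s, t)))"
    by (rule integral_prod_continuous) (intro continuous_intros continuous_on_mode2)
  also have "\<dots> = integral {0..a} (\<lambda>s. integral {0..b} (\<lambda>t.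
        (mode \<sigma> a j s * mode \<sigma> a l s) * (mode \<sigma> b k t * mode \<sigma> b m t)))"
    by (simp only: mode2_def p q fst_conv snd_conv box_real mult_ac)
  also have "\<dots> = integral {0..a} (\<lambda>s. mode \<sigma> a j s * mode \<sigma> a l s) *
      integral {0..b} (\<lambda>t. mode \<sigma> b k t * mode \<sigma> b m t)"
    by simp
  also have "\<dots> = 0"
    using integral_mode_mult_mode[OF assms(1,2), of j l] integral_mode_mult_mode[OF assms(1,3), of k m]
      assms(4) by (auto simp: p q)
  finally show ?thesis .
qed

lemma integral_mode2_sq_neq_0:
  assumes "a > 0" "b > 0"
  shows "integral (cbox (0, 0) (a, b)) (\<lambda>z. mode2 \<sigma> a b p z * mode2 \<sigma> a b p z) \<noteq> 0"
proof
  assume *: "integral (cbox (0, 0) (a, b)) (\<lambda>z. mode2 \<sigma> a b p z * mode2 \<sigma> a b p z) = 0"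
  have "continuous_on (cbox (0, 0) (a, b)) (\<lambda>z. mode2 \<sigma> a b p z * mode2 \<sigma> a b p z)"
    by (intro continuous_intros continuous_on_mode2)
  moreover have "box (0, 0) (a, b) \<noteq> {}"
    using assms by (auto simp: box_prod box_eq_empty)
  ultimately have "\<forall>z\<in>cbox (0, 0) (a, b). mode2 \<sigma> a b p z * mode2 \<sigma> a b p z = 0"
    using integral_cbox_eq_0_iff * by fastforce
  moreover have "(0, 0) \<in> cbox (0, 0) (a, b)" using assms by auto
  ultimately have "mode2 \<sigma> a b p (0, 0) * mode2 \<sigma> a b p (0, 0) = 0" by blast
  then show False
    using mode_0_pos[of \<sigma> a "fst p"] mode_0_pos[of \<sigma> b "snd p"] by (simp add: mode2_def)
qed

lemma mode2_neumann:
  assumes "a > 0" "b > 0"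
  shows "mode2 0 a b (j, k) = cos_mode a b (int j, int k)"
  using assms by (simp add: fun_eq_iff mode2_def mode_def cos_mode_def frequency_neumann mult.assoc)

lemma cos_mode_abs: "cos_mode a b (j, k) = cos_mode a b (\<bar>j\<bar>, \<bar>k\<bar>)"
  by (auto simp: cos_mode_def fun_eq_iff abs_if)

text \<open>For \<open>\<sigma> = 0\<close> the phases are zero and the product modes are the products of cosines; negative
  integer frequencies add nothing because \<open>cos\<close> is even.\<close>

lemma neumann_modes_complete:
  fixes W :: "real \<times> real \<Rightarrow> real"
  assumes ab: "a > 0" "b > 0" and W: "continuous_on (cbox (0, 0) (a, b)) W"
    and ortho: "\<And>q. integral (cbox (0, 0) (a, b)) (\<lambda>z. W z * mode2 0 a b q z) = 0"
    and z: "z \<in> cbox (0, 0) (a, b)"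
  shows "W z = 0"
proof (rule cos_modes_complete[OF ab W _ z])
  fix p :: "int \<times> int"
  have "cos_mode a b p = mode2 0 a b (nat \<bar>fst p\<bar>, nat \<bar>snd p\<bar>)"
    using mode2_neumann[OF ab] cos_mode_abs[of a b "fst p" "snd p"] by simp
  then show "integral (cbox (0, 0) (a, b)) (\<lambda>z. W z * cos_mode a b p z) = 0"
    using ortho by simp
qed

text \<open>The family \<open>e\<close> consists of functions on another space that become product modes in the
  coordinates \<open>T\<close>; the orthogonality of the latter gives independence.\<close>

lemma
  fixes e :: "nat \<times> nat \<Rightarrow> 'a \<Rightarrow> real" and T :: "real \<times> real \<Rightarrow> 'a"
  assumes "\<sigma> \<ge> 0" "a > 0" "b > 0"
    and e: "\<And>q z. z \<in> cbox (0, 0) (a, b) \<Longrightarrow> e q (T z) = mode2 \<sigma> a b q z"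
  shows modes_inj: "inj e" and modes_independent: "finite Q \<Longrightarrow> fun_vs.independent (e ` Q)"
proof -
  let ?I = "\<lambda>p q. integral (cbox (0, 0) (a, b)) (\<lambda>z. mode2 \<sigma> a b p z * mode2 \<sigma> a b q z)"
  show inj: "inj e"
  proof (rule injI, rule ccontr)
    fix p q assume "e p = e q" "p \<noteq> q"
    then have "?I p q = ?I p p"
      by (intro integral_cong) (simp flip: e)
    then show False
      using integral_mode2_mult_mode2[OF assms(1-3) \<open>p \<noteq> q\<close>] integral_mode2_sq_neq_0[OF assms(2,3)]
      by simp
  qed
  assume fin: "finite Q"
  show "fun_vs.independent (e ` Q)"
  proof (rule fun_vs.independent_if_scalars_zero)
    fix c f assume *: "(\<Sum>f\<in>e ` Q. (\<lambda>x. c f * f x)) = 0" and "f \<in> e ` Q"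
    then obtain p where p: "p \<in> Q" "f = e p" by blast
    have "(\<Sum>q\<in>Q. (\<lambda>x. c (e q) * e q x)) = 0"
      using * sum.reindex[OF inj_on_subset[OF inj subset_UNIV], of "\<lambda>f x. c f * f x" Q]
      by (simp add: o_def)
    moreover have "(\<Sum>q\<in>Q. (\<lambda>x. c (e q) * e q x)) x = (\<Sum>q\<in>Q. c (e q) * e q x)" for x
      using fin by (induction Q) auto
    ultimately have zero: "(\<Sum>q\<in>Q. c (e q) * e q x) = 0" for x
      by (metis zero_fun_def)
    have "0 = integral (cbox (0, 0) (a, b)) (\<lambda>z. (\<Sum>q\<in>Q. c (e q) * (mode2 \<sigma> a b p z * mode2 \<sigma> a b q z)))"
    proof -
      have "(\<Sum>q\<in>Q. c (e q) * (mode2 \<sigma> a b p z * mode2 \<sigma> a b q z)) = 0"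
        if "z \<in> cbox (0, 0) (a, b)" for z
      proof -
        have "(\<Sum>q\<in>Q. c (e q) * (mode2 \<sigma> a b p z * mode2 \<sigma> a b q z)) =
            mode2 \<sigma> a b p z * (\<Sum>q\<in>Q. c (e q) * e q (T z))"
          by (simp add: e[OF that] sum_distrib_left mult_ac)
        then show ?thesis using zero by simp
      qed
      then show ?thesis by (simp cong: integral_cong)
    qed
    also have "\<dots> = (\<Sum>q\<in>Q. c (e q) * ?I p q)"
      using fin by (subst integral_sum) (auto intro!: integrable_continuous continuous_intros continuous_on_mode2)
    also have "\<dots> = (\<Sum>q\<in>Q. if q = p then c (e q) * ?I p p else 0)"
      by (rule sum.cong) (use integral_mode2_mult_mode2[OF assms(1-3), of p] in auto)
    also have "\<dots> = c (e p) * ?I p p" using fin p by simp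
    finally show "c f = 0" using integral_mode2_sq_neq_0[OF assms(2,3), of \<sigma> p] p by simp
  qed (use fin in simp)
qed

section \<open>Rectangles in orthonormal coordinates\<close>

text \<open>The conditions on a gradient \<open>g\<close> and a Hessian \<open>H\<close> that witness membership in an eigenspace. They
  depend on the set only, so they can be read in different coordinates of the same rectangle.\<close>

definition robin_data :: "(real^'n) set \<Rightarrow> real \<Rightarrow> real \<Rightarrow> (real^'n \<Rightarrow> real) \<Rightarrow>
    (real^'n \<Rightarrow> real^'n) \<Rightarrow> (real^'n \<Rightarrow> real^'n^'n) \<Rightarrow> bool" where
  "robin_data \<Omega> \<sigma> \<mu> f g H \<longleftrightarrow>
        continuous_on (closure \<Omega>) g \<and>
        (\<forall>x\<in>closure \<Omega>. (f has_derivative (\<lambda>h. g x \<bullet> h)) (at x within closure \<Omega>)) \<and>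
        continuous_on \<Omega> H \<and>
        (\<forall>x\<in>\<Omega>. (g has_derivative (\<lambda>h. H x *v h)) (at x)) \<and>
        (\<forall>x\<in>\<Omega>. - trace (H x) = \<mu> * f x) \<and>
        (\<forall>x \<nu>. outward_normal \<Omega> x \<nu> \<longrightarrow> g x \<bullet> \<nu> + \<sigma> * f x = 0)"

lemma robin_eigenspace_iff:
  "f \<in> robin_eigenspace \<Omega> \<sigma> \<mu> \<longleftrightarrow>
    (\<forall>x. x \<notin> closure \<Omega> \<longrightarrow> f x = 0) \<and> (\<exists>g H. robin_data \<Omega> \<sigma> \<mu> f g H)"
  by (simp add: robin_eigenspace_def robin_data_def)

text \<open>A statement about one coordinate or one side is proved for the first coordinate or the side
  \<open>s = 0\<close> only. The other coordinate and the other sides are obtained from the frames of the same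
  rectangle given by \<open>swap\<close> and \<open>reflect\<close>.\<close>

locale rectangle_frame =
  fixes p u v :: "real^2" and a b :: real and \<Omega> :: "(real^2) set"
  assumes norm_u: "norm u = 1" and norm_v: "norm v = 1" and uv: "u \<bullet> v = 0"
    and a: "a > 0" and b: "b > 0"
    and \<Omega>: "\<Omega> = {p + s *\<^sub>R u + t *\<^sub>R v | s t. 0 < s \<and> s < a \<and> 0 < t \<and> t < b}"
begin

definition pt :: "real \<Rightarrow> real \<Rightarrow> real^2" where "pt s t = p + s *\<^sub>R u + t *\<^sub>R v"
definition cs :: "real^2 \<Rightarrow> real" where "cs x = (x - p) \<bullet> u"
definition ct :: "real^2 \<Rightarrow> real" where "ct x = (x - p) \<bullet> v"

lemma swap: "rectangle_frame p v u b a \<Omega>"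
proof
  have comm: "p + s *\<^sub>R u + t *\<^sub>R v = p + t *\<^sub>R v + s *\<^sub>R u" for s t
    by (simp add: algebra_simps)
  show "\<Omega> = {p + s *\<^sub>R v + t *\<^sub>R u | s t. 0 < s \<and> s < b \<and> 0 < t \<and> t < a}"
    unfolding \<Omega> comm by blast
qed (use norm_u norm_v uv a b in \<open>auto simp: inner_commute\<close>)

lemma reflect: "rectangle_frame (p + a *\<^sub>R u) (- u) v a b \<Omega>"
proof
  have "\<exists>s' t'. p + s *\<^sub>R u + t *\<^sub>R v = p + a *\<^sub>R u + s' *\<^sub>R - u + t' *\<^sub>R v \<and> 0 < s' \<and> s' < a \<and> 0 < t' \<and> t' < b"
    if "0 < s" "s < a" "0 < t" "t < b" for s t
    using that by (intro exI[of _ "a - s"] exI[of _ t]) (auto simp: algebra_simps)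
  moreover have "\<exists>s' t'. p + a *\<^sub>R u + s *\<^sub>R - u + t *\<^sub>R v = p + s' *\<^sub>R u + t' *\<^sub>R v \<and> 0 < s' \<and> s' < a \<and> 0 < t' \<and> t' < b"
    if "0 < s" "s < a" "0 < t" "t < b" for s t
    using that by (intro exI[of _ "a - s"] exI[of _ t]) (auto simp: algebra_simps)
  ultimately show "\<Omega> = {p + a *\<^sub>R u + s *\<^sub>R - u + t *\<^sub>R v | s t. 0 < s \<and> s < a \<and> 0 < t \<and> t < b}"
    unfolding \<Omega> by blast
qed (use norm_u norm_v uv a b in auto)

lemma uu: "u \<bullet> u = 1" and vv: "v \<bullet> v = 1" and vu: "v \<bullet> u = 0"
  using norm_u norm_v uv by (auto simp: norm_eq_1 inner_commute)

text \<open>The rows of an orthogonal matrix are orthonormal, hence so are its columns.\<close>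

lemma frame_components: "u $ i * u $ j + v $ i * v $ j = (if i = j then 1 else 0)"
proof -
  define A :: "real^2^2" where "A = vector [u, v]"
  have "A ** transpose A = mat 1"
    using uu vv uv vu
    by (simp add: A_def matrix_matrix_mult_def transpose_def mat_def vec_eq_iff forall_2 sum_2
        vector_2 inner_vec_def)
  then have "transpose A ** A = mat 1" by (simp add: matrix_left_right_inverse)
  then have "(transpose A ** A) $ i $ j = (mat 1 :: real^2^2) $ i $ j" by simp
  then show ?thesis
    by (simp add: A_def matrix_matrix_mult_def transpose_def mat_def sum_2 vector_2)
qed

lemma frame_expand: "(x \<bullet> u) *\<^sub>R u + (x \<bullet> v) *\<^sub>R v = x"
proof -
  have "((x \<bullet> u) *\<^sub>R u + (x \<bullet> v) *\<^sub>R v) $ i = x $ i" for i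
  proof -
    have "((x \<bullet> u) *\<^sub>R u + (x \<bullet> v) *\<^sub>R v) $ i =
        x $ 1 * (u $ 1 * u $ i + v $ 1 * v $ i) + x $ 2 * (u $ 2 * u $ i + v $ 2 * v $ i)"
      by (simp add: inner_vec_def sum_2 algebra_simps)
    then show ?thesis
      using exhaust_2[of i] by (auto simp: frame_components)
  qed
  then show ?thesis by (simp add: vec_eq_iff)
qed

text \<open>The Laplacian is the sum of the second derivatives along \<open>u\<close> and \<open>v\<close>.\<close>

lemma trace_frame: "trace H = (H *v u) \<bullet> u + (H *v v) \<bullet> v"
proof -
  have "(H *v u) \<bullet> u + (H *v v) \<bullet> v =
      H $ 1 $ 1 * (u $ 1 * u $ 1 + v $ 1 * v $ 1) + H $ 1 $ 2 * (u $ 1 * u $ 2 + v $ 1 * v $ 2) +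
      H $ 2 $ 1 * (u $ 1 * u $ 2 + v $ 1 * v $ 2) + H $ 2 $ 2 * (u $ 2 * u $ 2 + v $ 2 * v $ 2)"
    by (simp add: inner_vec_def matrix_vector_mult_def sum_2 algebra_simps)
  then show ?thesis by (simp add: frame_components trace_def sum_2)
qed

lemma pt_coords [simp]: "pt (cs x) (ct x) = x"
  using frame_expand[of "x - p"] by (simp add: pt_def cs_def ct_def add.assoc)

lemma cs_pt [simp]: "cs (pt s t) = s" and ct_pt [simp]: "ct (pt s t) = t"
  by (simp_all add: pt_def cs_def ct_def inner_add_left uu vv uv vu)

lemma mem_rect: "x \<in> \<Omega> \<longleftrightarrow> 0 < cs x \<and> cs x < a \<and> 0 < ct x \<and> ct x < b"
proof
  assume "x \<in> \<Omega>"
  then obtain s t where "x = pt s t" "0 < s \<and> s < a \<and> 0 < t \<and> t < b"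
    unfolding \<Omega> pt_def by blast
  then show "0 < cs x \<and> cs x < a \<and> 0 < ct x \<and> ct x < b" by simp
next
  assume "0 < cs x \<and> cs x < a \<and> 0 < ct x \<and> ct x < b"
  then show "x \<in> \<Omega>"
    unfolding \<Omega> by (intro CollectI exI[of _ "cs x"] exI[of _ "ct x"]) (simp flip: pt_def)
qed

lemma continuous_on_cs: "continuous_on S cs" and continuous_on_ct: "continuous_on S ct"
  unfolding cs_def ct_def by (intro continuous_intros)+

lemma continuous_on_pt: "continuous_on S (\<lambda>z. pt (fst z) (snd z))"
  unfolding pt_def by (intro continuous_intros)

lemma open_rect: "open \<Omega>"
proof -
  have "\<Omega> = {x. 0 < cs x} \<inter> {x. cs x < a} \<inter> {x. 0 < ct x} \<inter> {x. ct x < b}"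
    using mem_rect by auto
  then show ?thesis
    by (simp add: open_Int open_Collect_less continuous_on_cs continuous_on_ct)
qed

lemma mem_closure: "x \<in> closure \<Omega> \<longleftrightarrow> 0 \<le> cs x \<and> cs x \<le> a \<and> 0 \<le> ct x \<and> ct x \<le> b"
proof -
  define L where "L = (\<lambda>z. fst z *\<^sub>R u + snd z *\<^sub>R v)"
  have "linear L" unfolding L_def by unfold_locales (auto simp: algebra_simps)
  have L: "L z \<bullet> u = fst z" "L z \<bullet> v = snd z" for z
    by (simp_all add: L_def inner_add_left uu vv uv vu)
  then have "inj L" by (metis injI prod_eqI)
  have ptL: "pt s t = p + L (s, t)" for s t by (simp add: pt_def L_def add.assoc)
  have "\<Omega> = (+) p ` L ` box (0, 0) (a, b)"
  proof (intro equalityI subsetI)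
    fix x assume "x \<in> \<Omega>"
    then have "(cs x, ct x) \<in> box (0, 0) (a, b)" by (simp add: mem_rect mem_box_Pair)
    moreover have "x = p + L (cs x, ct x)" using pt_coords[of x] by (simp add: ptL)
    ultimately show "x \<in> (+) p ` L ` box (0, 0) (a, b)" by blast
  next
    fix x assume "x \<in> (+) p ` L ` box (0, 0) (a, b)"
    then obtain s t where "(s, t) \<in> box (0, 0) (a, b)" "x = pt s t" by (auto simp: ptL)
    then show "x \<in> \<Omega>" by (simp add: mem_rect mem_box_Pair)
  qed
  then have "closure \<Omega> = (+) p ` L ` closure (box (0, 0) (a, b))"
    using closure_injective_linear_image[OF \<open>linear L\<close> \<open>inj L\<close>] by (simp add: closure_translation)
  also have "closure (box (0, 0) (a, b)) = cbox (0, 0) (a, b)"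
    using a b by (intro closure_box) (auto simp: box_prod box_eq_empty)
  finally have eq: "closure \<Omega> = (+) p ` L ` cbox (0, 0) (a, b)" .
  show ?thesis
  proof
    assume "x \<in> closure \<Omega>"
    then obtain s t where "0 \<le> s" "s \<le> a" "0 \<le> t" "t \<le> b" "x = pt s t"
      unfolding eq ptL by auto
    then show "0 \<le> cs x \<and> cs x \<le> a \<and> 0 \<le> ct x \<and> ct x \<le> b" by simp
  next
    assume *: "0 \<le> cs x \<and> cs x \<le> a \<and> 0 \<le> ct x \<and> ct x \<le> b"
    have "x = p + L (cs x, ct x)" using pt_coords[of x] by (simp add: ptL)
    moreover have "(cs x, ct x) \<in> cbox (0, 0) (a, b)" using * by simp
    ultimately show "x \<in> closure \<Omega>" unfolding eq by blast
  qed
qed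

lemma pt_mem_closure: "pt s t \<in> closure \<Omega> \<longleftrightarrow> 0 \<le> s \<and> s \<le> a \<and> 0 \<le> t \<and> t \<le> b"
  by (simp add: mem_closure)

lemma pt_mem_rect: "pt s t \<in> \<Omega> \<longleftrightarrow> 0 < s \<and> s < a \<and> 0 < t \<and> t < b"
  by (simp add: mem_rect)

lemma inner_frame: "w \<bullet> y = (w \<bullet> u) * (y \<bullet> u) + (w \<bullet> v) * (y \<bullet> v)"
proof -
  have "w \<bullet> y = ((w \<bullet> u) *\<^sub>R u + (w \<bullet> v) *\<^sub>R v) \<bullet> y" by (simp only: frame_expand)
  then show ?thesis by (simp only: inner_add_left inner_scaleR_left inner_commute[of y])
qed

text \<open>\<open>- u\<close> is always a normal at a point of this side, so it is the only one if there is only one. This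
  covers the corners: no outward normal exists there, and the claim holds vacuously.\<close>

lemma normal_unique:
  assumes "x \<in> closure \<Omega>" "cs x = 0" "outward_normal \<Omega> x \<nu>"
  shows "\<nu> = - u"
proof -
  have "- u \<bullet> (y - x) \<le> 0" if "y \<in> \<Omega>" for y
  proof -
    have "u \<bullet> (y - x) = cs y - cs x" by (simp add: cs_def inner_diff_right inner_diff_left inner_commute)
    then show ?thesis using that assms(2) by (simp add: mem_rect)
  qed
  then have "norm (- u) = 1 \<and> (\<forall>y\<in>\<Omega>. - u \<bullet> (y - x) \<le> 0)" using norm_u by simp
  moreover have "(norm (- u) = 1 \<and> (\<forall>y\<in>\<Omega>. - u \<bullet> (y - x) \<le> 0)) \<longleftrightarrow> - u = \<nu>"
    using assms(3) unfolding outward_normal_def by (elim conjE) (rule spec)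
  ultimately show ?thesis by simp
qed

lemma normal_exists:
  assumes "0 < t" "t < b"
  shows "outward_normal \<Omega> (pt 0 t) (- u)"
  unfolding outward_normal_def
proof (intro conjI allI)
  show "pt 0 t \<in> frontier \<Omega>"
    using assms a by (simp add: frontier_def interior_open[OF open_rect] pt_mem_closure pt_mem_rect)
  fix w
  have diff: "w \<bullet> (pt s t' - pt 0 t) = s * (w \<bullet> u) + (t' - t) * (w \<bullet> v)" for s t'
    by (simp add: pt_def inner_add_right inner_diff_right algebra_simps)
  show "(norm w = 1 \<and> (\<forall>y\<in>\<Omega>. w \<bullet> (y - pt 0 t) \<le> 0)) = (w = - u)"
  proof
    assume w: "norm w = 1 \<and> (\<forall>y\<in>\<Omega>. w \<bullet> (y - pt 0 t) \<le> 0)"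
    then have le: "s * (w \<bullet> u) + (t' - t) * (w \<bullet> v) \<le> 0" if "0 < s" "s < a" "0 < t'" "t' < b" for s t'
      using that diff[of s t'] pt_mem_rect by metis
    have lim: "(t' - t) * (w \<bullet> v) \<le> 0" if "0 < t'" "t' < b" for t'
    proof (rule tendsto_upperbound)
      show "((\<lambda>s. s * (w \<bullet> u) + (t' - t) * (w \<bullet> v)) \<longlongrightarrow> (t' - t) * (w \<bullet> v)) (at_right 0)"
        by (auto intro!: tendsto_eq_intros)
      show "\<forall>\<^sub>F s in at_right 0. s * (w \<bullet> u) + (t' - t) * (w \<bullet> v) \<le> 0"
        using eventually_at_right_real[OF a] by eventually_elim (use le that in auto)
    qed simp
    have neg: "t / 2 - t < 0" and pos: "(t + b) / 2 - t > 0"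
      using assms by (simp_all add: field_simps)
    have "(t / 2 - t) * (w \<bullet> v) \<le> 0" "((t + b) / 2 - t) * (w \<bullet> v) \<le> 0"
      by (rule lim; use assms in simp)+
    then have "\<not> w \<bullet> v < 0" "\<not> w \<bullet> v > 0"
      using mult_neg_neg[OF neg] mult_pos_pos[OF pos] not_le by blast+
    then have "w \<bullet> v = 0" by simp
    moreover from this have "w \<bullet> u \<le> 0"
      using le[of "a / 2" t] a assms by (auto simp: mult_le_0_iff)
    moreover have "(w \<bullet> u) * (w \<bullet> u) + (w \<bullet> v) * (w \<bullet> v) = 1"
      using w inner_frame[of w w] by (simp add: norm_eq_1)
    ultimately have "w \<bullet> u = -1" by (simp add: square_eq_1_iff)
    then show "w = - u" using frame_expand[of w] \<open>w \<bullet> v = 0\<close> by simp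
  next
    assume w: "w = - u"
    have "w \<bullet> (y - pt 0 t) \<le> 0" if "y \<in> \<Omega>" for y
    proof -
      have "w \<bullet> (pt (cs y) (ct y) - pt 0 t) \<le> 0"
        unfolding diff using that by (simp add: w uu uv mem_rect)
      then show ?thesis by simp
    qed
    then show "norm w = 1 \<and> (\<forall>y\<in>\<Omega>. w \<bullet> (y - pt 0 t) \<le> 0)" using w norm_u by simp
  qed
qed

lemma frontier_cases:
  assumes "x \<in> frontier \<Omega>"
  shows "x \<in> closure \<Omega>" and "cs x = 0 \<or> cs x = a \<or> ct x = 0 \<or> ct x = b"
  using assms by (auto simp: frontier_def interior_open[OF open_rect] mem_closure mem_rect)

section \<open>Eigenfunctions in coordinates\<close>

lemma robin_data_D1:
  assumes "robin_data \<Omega> \<sigma> \<mu> f g H" "0 \<le> s" "s \<le> a" "0 \<le> t" "t \<le> b"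
  shows "((\<lambda>s. f (pt s t)) has_real_derivative g (pt s t) \<bullet> u) (at s within {0..a})"
proof -
  have sub: "(\<lambda>s. pt s t) ` {0..a} \<subseteq> closure \<Omega>"
    using assms by (auto simp: pt_mem_closure)
  have "(f has_derivative (\<lambda>h. g (pt s t) \<bullet> h)) (at (pt s t) within (\<lambda>s. pt s t) ` {0..a})"
    using assms sub pt_mem_closure unfolding robin_data_def
    by (meson has_derivative_subset)
  moreover have "((\<lambda>s. pt s t) has_derivative (\<lambda>h. h *\<^sub>R u)) (at s within {0..a})"
    unfolding pt_def by (auto intro!: derivative_eq_intros)
  ultimately have "((\<lambda>s. f (pt s t)) has_derivative (\<lambda>h. g (pt s t) \<bullet> (h *\<^sub>R u))) (at s within {0..a})"
    using has_derivative_in_compose by blast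
  then show ?thesis
    by (simp add: has_field_derivative_def mult_commute_abs)
qed

lemma robin_data_D2:
  assumes "robin_data \<Omega> \<sigma> \<mu> f g H" "0 < s" "s < a" "0 < t" "t < b"
  shows "((\<lambda>s. g (pt s t) \<bullet> u) has_real_derivative (H (pt s t) *v u) \<bullet> u) (at s)"
proof -
  have "(g has_derivative (\<lambda>h. H (pt s t) *v h)) (at (pt s t))"
    using assms unfolding robin_data_def by (simp add: pt_mem_rect)
  moreover have "((\<lambda>s. pt s t) has_derivative (\<lambda>h. h *\<^sub>R u)) (at s)"
    unfolding pt_def by (auto intro!: derivative_eq_intros)
  ultimately have "((\<lambda>s. g (pt s t)) has_derivative (\<lambda>h. H (pt s t) *v (h *\<^sub>R u))) (at s)"
    by (rule has_derivative_compose[rotated])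
  from has_derivative_inner_left[OF this, of u]
  show ?thesis
    by (simp add: has_field_derivative_def mult_commute_abs matrix_vector_mult_scaleR)
qed

lemma robin_data_continuous:
  assumes "robin_data \<Omega> \<sigma> \<mu> f g H"
  shows "continuous_on (closure \<Omega>) f"
  using assms unfolding robin_data_def by (meson has_derivative_continuous_on)

text \<open>The boundary condition is given where the normal is unique; at the corners it follows
  by continuity of the gradient.\<close>

lemma robin_data_left:
  assumes R: "robin_data \<Omega> \<sigma> \<mu> f g H" and t: "0 \<le> t" "t \<le> b"
  shows "g (pt 0 t) \<bullet> u = \<sigma> * f (pt 0 t)"
proof -
  have cpt: "continuous_on {0..b} (pt 0)" unfolding pt_def by (intro continuous_intros)
  have sub: "pt 0 ` {0..b} \<subseteq> closure \<Omega>" using a by (auto simp: pt_mem_closure)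
  have "continuous_on (closure {0<..<b}) (\<lambda>t. g (pt 0 t) \<bullet> u - \<sigma> * f (pt 0 t))"
    using b R[unfolded robin_data_def] robin_data_continuous[OF R]
    by (auto intro!: continuous_intros continuous_on_compose2[OF _ cpt sub])
  moreover have "g (pt 0 t) \<bullet> u - \<sigma> * f (pt 0 t) = 0" if "t \<in> {0<..<b}" for t
  proof -
    have "g (pt 0 t) \<bullet> (- u) + \<sigma> * f (pt 0 t) = 0"
      using R normal_exists[of t] that unfolding robin_data_def greaterThanLessThan_iff by blast
    then show ?thesis by simp
  qed
  moreover have "t \<in> closure {0<..<b}" using t b by simp
  ultimately have "g (pt 0 t) \<bullet> u - \<sigma> * f (pt 0 t) = 0"
    by (rule continuous_constant_on_closure)
  then show ?thesis by simp
qed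

lemma robin_data_right:
  assumes R: "robin_data \<Omega> \<sigma> \<mu> f g H" and t: "0 \<le> t" "t \<le> b"
  shows "g (pt a t) \<bullet> u = - \<sigma> * f (pt a t)"
proof -
  interpret r: rectangle_frame "p + a *\<^sub>R u" "- u" v a b \<Omega> by (rule reflect)
  have "r.pt 0 t = pt a t" by (simp add: r.pt_def pt_def)
  then show ?thesis using r.robin_data_left[OF R t] by simp
qed

end

section \<open>Absence of negative Robin eigenvalues\<close>

text \<open>At an end point the Robin condition makes a positive function increase into the interval, so a
  positive maximum is interior and has non-positive second derivative. The statement is
  one-dimensional in order to be applied to both coordinates of a maximum in the rectangle, corners
  included.\<close>

lemma robin_max_interior:
  fixes q q' :: "real \<Rightarrow> real"
  assumes d: "\<And>s. s \<in> {0..a} \<Longrightarrow> (q has_real_derivative q' s) (at s within {0..a})"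
    and "a > 0" "\<sigma> > 0" "q' 0 = \<sigma> * q 0" "q' a = - \<sigma> * q a"
    and s: "s \<in> {0..a}" and pos: "q s > 0" and max: "\<And>r. r \<in> {0..a} \<Longrightarrow> q r \<le> q s"
  shows "0 < s" "s < a"
    and "(q' has_real_derivative c) (at s) \<Longrightarrow> c \<le> 0"
proof -
  show s0: "0 < s"
  proof (rule ccontr)
    assume "\<not> 0 < s"
    then have "s = 0" using s by simp
    then have "(q has_real_derivative \<sigma> * q s) (at s within {0..a})" "\<sigma> * q s > 0"
      using d[OF s] assms(3,4) pos by auto
    from has_real_derivative_pos_inc_right[OF this] obtain e where
      e: "e > 0" "\<And>h. h > 0 \<Longrightarrow> s + h \<in> {0..a} \<Longrightarrow> h < e \<Longrightarrow> q s < q (s + h)" by blast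
    define h where "h = min (e / 2) a"
    have "h > 0" "s + h \<in> {0..a}" "h < e" using e(1) \<open>a > 0\<close> \<open>s = 0\<close> by (auto simp: h_def)
    then show False using e(2)[of h] max[of "s + h"] by simp
  qed
  show sa: "s < a"
  proof (rule ccontr)
    assume "\<not> s < a"
    then have "s = a" using s by simp
    then have "(q has_real_derivative - (\<sigma> * q s)) (at s within {0..a})" "- (\<sigma> * q s) < 0"
      using d[OF s] assms(3,5) pos by auto
    from has_real_derivative_neg_dec_left[OF this] obtain e where
      e: "e > 0" "\<And>h. h > 0 \<Longrightarrow> s - h \<in> {0..a} \<Longrightarrow> h < e \<Longrightarrow> q s < q (s - h)" by blast
    define h where "h = min (e / 2) a"
    have "h > 0" "s - h \<in> {0..a}" "h < e" using e(1) \<open>a > 0\<close> \<open>s = a\<close> by (auto simp: h_def)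
    then show False using e(2)[of h] max[of "s - h"] by simp
  qed
  have D: "(q has_real_derivative q' r) (at r)" if "0 < r" "r < a" for r
    using d[of r] that at_within_Icc_at[of 0 r a] by simp
  have "q' s = 0"
    by (rule DERIV_local_max[OF D[OF s0 sa], of "min s (a - s)"])
      (use s0 sa max in \<open>auto simp: abs_less_iff\<close>)
  assume c: "(q' has_real_derivative c) (at s)"
  show "c \<le> 0"
  proof (rule ccontr)
    assume "\<not> c \<le> 0"
    then obtain e where e: "e > 0" "\<And>h. h > 0 \<Longrightarrow> h < e \<Longrightarrow> q' s < q' (s + h)"
      using DERIV_pos_inc_right[OF c] by auto
    define h where "h = min (e / 2) ((a - s) / 2)"
    have "h \<le> (a - s) / 2" unfolding h_def by (rule min.cobounded2)
    then have h: "h > 0" "h < e" "s + h < a" using e(1) sa by (auto simp: h_def)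
    obtain \<xi> where \<xi>: "s < \<xi>" "\<xi> < s + h" "q (s + h) - q s = (s + h - s) * q' \<xi>"
      using MVT2[of s "s + h" q q'] D h s0 by auto
    have "q' s < q' \<xi>" using e(2)[of "\<xi> - s"] \<xi> h by simp
    then have "q (s + h) > q s" using \<xi>(3) h(1) \<open>q' s = 0\<close> by (simp add: algebra_simps)
    then show False using max[of "s + h"] h s0 by simp
  qed
qed

context rectangle_frame
begin

lemma compact_closure: "compact (closure \<Omega>)"
proof -
  have "closure \<Omega> = (\<lambda>z. pt (fst z) (snd z)) ` cbox (0, 0) (a, b)"
  proof (intro equalityI subsetI)
    fix x assume "x \<in> closure \<Omega>"
    then have "(cs x, ct x) \<in> cbox (0, 0) (a, b)" by (simp add: mem_closure)
    then show "x \<in> (\<lambda>z. pt (fst z) (snd z)) ` cbox (0, 0) (a, b)"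
      by (rule rev_image_eqI) simp
  qed (auto simp: mem_closure)
  then show ?thesis
    using compact_continuous_image[OF continuous_on_pt compact_cbox] by metis
qed

text \<open>At a positive maximum both pure second derivatives are non-positive, whereas the Laplacian
  \<open>- \<mu> f\<close> is positive.\<close>

lemma robin_eigenfunction_nonpos:
  assumes "\<sigma> > 0" "\<mu> < 0" "f \<in> robin_eigenspace \<Omega> \<sigma> \<mu>"
  shows "f x \<le> 0"
proof (rule ccontr)
  assume fx: "\<not> f x \<le> 0"
  obtain g H where R: "robin_data \<Omega> \<sigma> \<mu> f g H" and zero: "\<And>x. x \<notin> closure \<Omega> \<Longrightarrow> f x = 0"
    using assms(3) unfolding robin_eigenspace_iff by blast
  have xc: "x \<in> closure \<Omega>" using zero fx by force
  then have "closure \<Omega> \<noteq> {}" by auto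
  from continuous_attains_sup[OF compact_closure this robin_data_continuous[OF R]]
  obtain m where m: "m \<in> closure \<Omega>" "\<And>y. y \<in> closure \<Omega> \<Longrightarrow> f y \<le> f m"
    by blast
  define s t where "s = cs m" and "t = ct m"
  have m': "m = pt s t" by (simp add: s_def t_def)
  have st: "0 \<le> s" "s \<le> a" "0 \<le> t" "t \<le> b" using m(1) by (auto simp: s_def t_def mem_closure)
  have pos: "f (pt s t) > 0" using m(2)[OF xc] fx m' by simp
  interpret w: rectangle_frame p v u b a \<Omega> by (rule swap)
  have pts: "w.pt t s = pt s t" for s t by (simp add: w.pt_def pt_def add.assoc add.commute)
  have max1: "f (pt r t) \<le> f (pt s t)" if "r \<in> {0..a}" for r
    using m(2)[of "pt r t"] that st m' by (simp add: pt_mem_closure)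
  have max2: "f (pt s r) \<le> f (pt s t)" if "r \<in> {0..b}" for r
    using m(2)[of "pt s r"] that st m' by (simp add: pt_mem_closure)
  have 1: "((\<lambda>s. f (pt s t)) has_real_derivative g (pt r t) \<bullet> u) (at r within {0..a})"
    if "r \<in> {0..a}" for r using robin_data_D1[OF R] that st by simp
  note I = robin_max_interior[of a "\<lambda>s. f (pt s t)" "\<lambda>s. g (pt s t) \<bullet> u" \<sigma> s, OF 1 a assms(1)
      robin_data_left[OF R st(3,4)] robin_data_right[OF R st(3,4)] _ pos max1]
  have 2: "((\<lambda>t. f (pt s t)) has_real_derivative g (pt s r) \<bullet> v) (at r within {0..b})"
    if "r \<in> {0..b}" for r using w.robin_data_D1[OF R] that st by (simp add: pts)
  note J = robin_max_interior[of b "\<lambda>t. f (pt s t)" "\<lambda>t. g (pt s t) \<bullet> v" \<sigma> t, OF 2 b assms(1)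
      w.robin_data_left[OF R st(1,2), unfolded pts] w.robin_data_right[OF R st(1,2), unfolded pts] _ pos max2]
  have int: "0 < s" "s < a" "0 < t" "t < b" using I(1,2) J(1,2) st by auto
  have "(H (pt s t) *v u) \<bullet> u \<le> 0"
    by (rule I(3)[OF _ _ _ robin_data_D2[OF R int]]) (use st in auto)
  moreover have "(H (pt s t) *v v) \<bullet> v \<le> 0"
    by (rule J(3)[OF _ _ _ w.robin_data_D2[OF R int(3,4,1,2), unfolded pts]]) (use st in auto)
  moreover have "- trace (H (pt s t)) = \<mu> * f (pt s t)"
    using R int unfolding robin_data_def by (simp add: pt_mem_rect)
  moreover have "\<mu> * f (pt s t) < 0" using assms(2) pos by (simp add: mult_neg_pos)
  ultimately show False by (simp add: trace_frame)
qed

lemma robin_eigenfunction_negative_eq_0: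
  assumes "\<sigma> > 0" "\<mu> < 0" "f \<in> robin_eigenspace \<Omega> \<sigma> \<mu>"
  shows "f = 0"
proof
  fix x
  have "(\<lambda>x. (-1) * f x) \<in> robin_eigenspace \<Omega> \<sigma> \<mu>"
    by (rule fun_vs.subspace_scale[OF robin_eigenspace_subspace assms(3)])
  from robin_eigenfunction_nonpos[OF assms(1,2) this, of x]
    robin_eigenfunction_nonpos[OF assms, of x]
  show "f x = 0 x" by simp
qed

end

section \<open>Product modes as eigenfunctions\<close>

definition mode2_eigenvalue :: "real \<Rightarrow> real \<Rightarrow> real \<Rightarrow> nat \<times> nat \<Rightarrow> real" where
  "mode2_eigenvalue \<sigma> a b q = (frequency \<sigma> a (fst q))\<^sup>2 + (frequency \<sigma> b (snd q))\<^sup>2"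

lemma mode2_eigenvalue_le:
  assumes "\<sigma> \<ge> 0" "a > 0" "b > 0"
  shows "mode2_eigenvalue \<sigma> a b q \<le> mode2_eigenvalue 0 a b q + (4 * \<sigma> / a + 4 * \<sigma> / b)"
  using frequency_sq_le[OF assms(1,2), of "fst q"] frequency_sq_le[OF assms(1,3), of "snd q"]
  unfolding mode2_eigenvalue_def by linarith

lemma finite_neumann_eigenvalues_le:
  assumes ab: "a > 0" "b > 0"
  shows "finite {q. mode2_eigenvalue 0 a b q \<le> t}"
proof -
  have *: "j \<le> nat \<lceil>c * sqrt t / pi\<rceil>" if "(frequency 0 c j)\<^sup>2 \<le> t" "c > 0" for c and j :: nat
  proof -
    have "frequency 0 c j \<le> sqrt t" using that(1) by (rule real_le_rsqrt)
    then have "real j \<le> c * sqrt t / pi" using that(2) by (simp add: frequency_neumann field_simps)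
    then show ?thesis by linarith
  qed
  have "{q. mode2_eigenvalue 0 a b q \<le> t} \<subseteq> {..nat \<lceil>a * sqrt t / pi\<rceil>} \<times> {..nat \<lceil>b * sqrt t / pi\<rceil>}"
  proof
    fix q assume "q \<in> {q. mode2_eigenvalue 0 a b q \<le> t}"
    then have "(frequency 0 a (fst q))\<^sup>2 + (frequency 0 b (snd q))\<^sup>2 \<le> t" by (simp add: mode2_eigenvalue_def)
    then have "(frequency 0 a (fst q))\<^sup>2 \<le> t" "(frequency 0 b (snd q))\<^sup>2 \<le> t"
      using zero_le_power2[of "frequency 0 a (fst q)"] zero_le_power2[of "frequency 0 b (snd q)"] by linarith+
    then show "q \<in> {..nat \<lceil>a * sqrt t / pi\<rceil>} \<times> {..nat \<lceil>b * sqrt t / pi\<rceil>}"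
      using *[of a "fst q"] *[of b "snd q"] ab by (cases q) auto
  qed
  then show ?thesis by (rule finite_subset) simp
qed

context rectangle_frame
begin

text \<open>The extension by \<open>0\<close> outside the closure is the representation used for eigenfunctions.\<close>

definition rect_mode :: "real \<Rightarrow> nat \<times> nat \<Rightarrow> real^2 \<Rightarrow> real" where
  "rect_mode \<sigma> q x = (if x \<in> closure \<Omega> then mode2 \<sigma> a b q (cs x, ct x) else 0)"

lemma rect_mode_pt: "z \<in> cbox (0, 0) (a, b) \<Longrightarrow> rect_mode \<sigma> q (pt (fst z) (snd z)) = mode2 \<sigma> a b q z"
  by (cases z) (simp add: rect_mode_def pt_mem_closure)

lemma outward_normal_cases:
  assumes "outward_normal \<Omega> x \<nu>"
  obtains "cs x = 0" "\<nu> = - u" | "cs x = a" "\<nu> = u" | "ct x = 0" "\<nu> = - v" | "ct x = b" "\<nu> = v"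
proof -
  interpret r: rectangle_frame "p + a *\<^sub>R u" "- u" v a b \<Omega> by (rule reflect)
  interpret w: rectangle_frame p v u b a \<Omega> by (rule swap)
  interpret wr: rectangle_frame "p + b *\<^sub>R v" "- v" u b a \<Omega> by (rule w.reflect)
  have c: "r.cs x = a - cs x" "w.cs x = ct x" "wr.cs x = b - ct x"
    by (simp_all add: r.cs_def cs_def w.cs_def ct_def wr.cs_def inner_diff_left inner_add_left uu vv)
  have "x \<in> frontier \<Omega>" using assms by (simp add: outward_normal_def)
  note x = frontier_cases[OF this]
  consider "cs x = 0" | "cs x = a" | "ct x = 0" | "ct x = b" using x(2) by blast
  then show thesis
  proof cases
    case 1
    then show thesis using normal_unique[OF x(1) _ assms] that by simp
  next
    case 2
    then show thesis using r.normal_unique[OF x(1) _ assms] c that by simp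
  next
    case 3
    then show thesis using w.normal_unique[OF x(1) _ assms] c that by simp
  next
    case 4
    then show thesis using wr.normal_unique[OF x(1) _ assms] c that by simp
  qed
qed

lemma has_derivative_cs: "(cs has_derivative (\<lambda>h. h \<bullet> u)) F"
  and has_derivative_ct: "(ct has_derivative (\<lambda>h. h \<bullet> v)) F"
  unfolding cs_def ct_def by (auto intro!: derivative_eq_intros)

lemma has_derivative_compose_cs:
  "(\<And>s. (y has_real_derivative y' s) (at s)) \<Longrightarrow>
    ((\<lambda>x. y (cs x)) has_derivative (\<lambda>h. (h \<bullet> u) * y' (cs x))) (at x within S)"
  by (rule DERIV_compose_FDERIV[OF _ has_derivative_cs])

lemma has_derivative_compose_ct:
  "(\<And>s. (y has_real_derivative y' s) (at s)) \<Longrightarrow>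
    ((\<lambda>x. y (ct x)) has_derivative (\<lambda>h. (h \<bullet> v) * y' (ct x))) (at x within S)"
  by (rule DERIV_compose_FDERIV[OF _ has_derivative_ct])

text \<open>In the frame the Hessian has the entries \<open>A = y'' z\<close>, \<open>B = y' z'\<close> and \<open>C = y z''\<close>, where \<open>y\<close> and
  \<open>z\<close> are the two factors.\<close>

lemma rect_mode_mem_eigenspace:
  assumes "\<sigma> \<ge> 0"
  shows "rect_mode \<sigma> q \<in> robin_eigenspace \<Omega> \<sigma> (mode2_eigenvalue \<sigma> a b q)"
proof -
  define y where "y = mode \<sigma> a (fst q)"
  define y' where "y' = mode_deriv \<sigma> a (fst q)"
  define z where "z = mode \<sigma> b (snd q)"
  define z' where "z' = mode_deriv \<sigma> b (snd q)"
  define \<alpha> where "\<alpha> = frequency \<sigma> a (fst q)"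
  define \<beta> where "\<beta> = frequency \<sigma> b (snd q)"
  define A B C where "A = (\<lambda>x. - \<alpha>\<^sup>2 * y (cs x) * z (ct x))" and "B = (\<lambda>x. y' (cs x) * z' (ct x))"
    and "C = (\<lambda>x. - \<beta>\<^sup>2 * y (cs x) * z (ct x))"
  define g where "g = (\<lambda>x. (y' (cs x) * z (ct x)) *\<^sub>R u + (y (cs x) * z' (ct x)) *\<^sub>R v)"
  define H where "H = (\<lambda>x. (\<chi> i l. A x * (u $ i * u $ l) + B x * (u $ i * v $ l + v $ i * u $ l) +
    C x * (v $ i * v $ l)) :: real^2^2)"
  have d: "(y has_real_derivative y' s) (at s)" "(z has_real_derivative z' s) (at s)"
    "(y' has_real_derivative - \<alpha>\<^sup>2 * y s) (at s)" "(z' has_real_derivative - \<beta>\<^sup>2 * z s) (at s)" for s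
    unfolding y_def y'_def z_def z'_def \<alpha>_def \<beta>_def
    by (rule DERIV_mode DERIV_mode_deriv)+
  note D = has_derivative_compose_cs[OF d(1)] has_derivative_compose_ct[OF d(2)]
    has_derivative_compose_cs[OF d(3)] has_derivative_compose_ct[OF d(4)]
  have cont: "continuous_on S (\<lambda>x. y (cs x))" "continuous_on S (\<lambda>x. y' (cs x))"
    "continuous_on S (\<lambda>x. z (ct x))" "continuous_on S (\<lambda>x. z' (ct x))" for S
    unfolding y_def y'_def z_def z'_def
    by (auto intro!: continuous_on_compose2[OF continuous_on_mode] continuous_on_compose2[OF continuous_on_mode_deriv]
      continuous_on_cs continuous_on_ct)
  have Hv: "H x *v h = (A x * (h \<bullet> u) + B x * (h \<bullet> v)) *\<^sub>R u + (B x * (h \<bullet> u) + C x * (h \<bullet> v)) *\<^sub>R v" for x h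
    by (simp add: H_def vec_eq_iff matrix_vector_mult_def inner_vec_def sum_2 algebra_simps)
  have f: "rect_mode \<sigma> q x = y (cs x) * z (ct x)" if "x \<in> closure \<Omega>" for x
    using that by (simp add: rect_mode_def mode2_def y_def z_def)
  have "robin_data \<Omega> \<sigma> (mode2_eigenvalue \<sigma> a b q) (rect_mode \<sigma> q) g H"
    unfolding robin_data_def
  proof (intro conjI ballI allI impI)
    show "continuous_on (closure \<Omega>) g"
      unfolding g_def by (intro continuous_intros cont)
    show "continuous_on \<Omega> H"
      unfolding H_def A_def B_def C_def by (intro continuous_intros cont)
  next
    fix x assume x: "x \<in> closure \<Omega>"
    have "((\<lambda>x. y (cs x) * z (ct x)) has_derivative (\<lambda>h. g x \<bullet> h)) (at x within closure \<Omega>)"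
      by (rule has_derivative_eq_rhs[OF has_derivative_mult[OF D(1,2)]])
        (simp add: fun_eq_iff g_def inner_add_left inner_commute algebra_simps)
    then show "(rect_mode \<sigma> q has_derivative (\<lambda>h. g x \<bullet> h)) (at x within closure \<Omega>)"
      by (rule has_derivative_transform[OF x, rotated]) (rule f)
  next
    fix x assume x: "x \<in> \<Omega>"
    show "(g has_derivative (\<lambda>h. H x *v h)) (at x)"
      unfolding g_def
      by (rule has_derivative_eq_rhs[OF has_derivative_add[OF
            has_derivative_scaleR_left[OF has_derivative_mult[OF D(3,2)]]
            has_derivative_scaleR_left[OF has_derivative_mult[OF D(1,4)]]]])
        (simp add: fun_eq_iff Hv A_def B_def C_def algebra_simps)
    have "x \<in> closure \<Omega>" using x closure_subset by blast
    then show "- trace (H x) = mode2_eigenvalue \<sigma> a b q * rect_mode \<sigma> q x"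
      by (simp add: trace_frame Hv inner_add_left uu vv uv vu A_def C_def f mode2_eigenvalue_def
          \<alpha>_def \<beta>_def algebra_simps)
  next
    fix x \<nu> assume n: "outward_normal \<Omega> x \<nu>"
    then have x: "x \<in> closure \<Omega>" using frontier_cases by (auto simp: outward_normal_def)
    have bc: "y' 0 = \<sigma> * y 0" "y' a = - \<sigma> * y a" "z' 0 = \<sigma> * z 0" "z' b = - \<sigma> * z b"
      unfolding y_def y'_def z_def z'_def
      by (rule mode_robin_left mode_robin_right assms a b)+
    from n show "g x \<bullet> \<nu> + \<sigma> * rect_mode \<sigma> q x = 0"
      by (cases rule: outward_normal_cases)
        (simp_all add: f[OF x] g_def inner_add_left inner_diff_left uu vv uv vu bc)
  qed
  then show ?thesis
    unfolding robin_eigenspace_iff by (auto simp: rect_mode_def)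
qed

section \<open>Neumann eigenfunctions\<close>

lemma robin_data_D1_interior:
  assumes "robin_data \<Omega> \<sigma> \<mu> f g H" "0 < s" "s < a" "0 < t" "t < b"
  shows "((\<lambda>s. f (pt s t)) has_real_derivative g (pt s t) \<bullet> u) (at s)"
  using robin_data_D1[OF assms(1), of s t] assms by (simp add: at_within_Icc_at)

lemma continuous_on_compose_pt:
  assumes "continuous_on (closure \<Omega>) f"
  shows "continuous_on (cbox (0, 0) (a, b)) (\<lambda>z. f (pt (fst z) (snd z)))"
  by (rule continuous_on_compose2[OF assms continuous_on_pt]) (auto simp: pt_mem_closure)

lemma continuous_on_compose_pt_interior:
  assumes "continuous_on \<Omega> f"
  shows "continuous_on (box (0, 0) (a, b)) (\<lambda>z. f (pt (fst z) (snd z)))"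
  by (rule continuous_on_compose2[OF assms continuous_on_pt]) (auto simp: pt_mem_rect mem_box_Pair)

text \<open>Green's identity: the field \<open>\<phi> \<nabla>f - f \<nabla>\<phi>\<close>, with \<open>\<phi>\<close> the product mode, has divergence
  \<open>(\<lambda> - \<mu>) f \<phi>\<close>, where \<open>\<lambda>\<close> is the eigenvalue of \<open>\<phi>\<close>. Its normal component vanishes on the boundary
  since both functions satisfy the same Robin condition.\<close>

lemma integral_eigenfunction_mult_mode2:
  assumes "\<sigma> \<ge> 0" "f \<in> robin_eigenspace \<Omega> \<sigma> \<mu>" "\<mu> \<noteq> mode2_eigenvalue \<sigma> a b q"
  shows "integral (cbox (0, 0) (a, b)) (\<lambda>z. f (pt (fst z) (snd z)) * mode2 \<sigma> a b q z) = 0"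
proof -
  obtain g H where R: "robin_data \<Omega> \<sigma> \<mu> f g H"
    using assms(2) unfolding robin_eigenspace_iff by blast
  define y where "y = mode \<sigma> a (fst q)"
  define y' where "y' = mode_deriv \<sigma> a (fst q)"
  define z where "z = mode \<sigma> b (snd q)"
  define z' where "z' = mode_deriv \<sigma> b (snd q)"
  define \<alpha> where "\<alpha> = frequency \<sigma> a (fst q)"
  define \<beta> where "\<beta> = frequency \<sigma> b (snd q)"
  have d: "(y has_real_derivative y' s) (at s)" "(z has_real_derivative z' s) (at s)"
    "(y' has_real_derivative - \<alpha>\<^sup>2 * y s) (at s)" "(z' has_real_derivative - \<beta>\<^sup>2 * z s) (at s)" for s
    unfolding y_def y'_def z_def z'_def \<alpha>_def \<beta>_def
    by (rule DERIV_mode DERIV_mode_deriv)+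
  have cont: "continuous_on S (\<lambda>w. y (fst w))" "continuous_on S (\<lambda>w. y' (fst w))"
    "continuous_on S (\<lambda>w. z (snd w))" "continuous_on S (\<lambda>w. z' (snd w))" for S :: "(real \<times> real) set"
    unfolding y_def y'_def z_def z'_def
    by (auto intro!: continuous_on_compose2[OF continuous_on_mode] continuous_on_compose2[OF continuous_on_mode_deriv]
      continuous_intros)
  have bc: "y' 0 = \<sigma> * y 0" "y' a = - \<sigma> * y a" "z' 0 = \<sigma> * z 0" "z' b = - \<sigma> * z b"
    unfolding y_def y'_def z_def z'_def
    by (rule mode_robin_left mode_robin_right assms a b)+
  interpret w: rectangle_frame p v u b a \<Omega> by (rule swap)
  have pts: "w.pt t s = pt s t" for s t by (simp add: w.pt_def pt_def add.assoc add.commute)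
  let ?P = "\<lambda>w. pt (fst w) (snd w)"
  define F where "F = (\<lambda>w. f (?P w))"
  define X where "X = (\<lambda>w. g (?P w) \<bullet> u * (y (fst w) * z (snd w)) - F w * (y' (fst w) * z (snd w)))"
  define Y where "Y = (\<lambda>w. g (?P w) \<bullet> v * (y (fst w) * z (snd w)) - F w * (y (fst w) * z' (snd w)))"
  define X' where "X' = (\<lambda>w. (H (?P w) *v u) \<bullet> u * (y (fst w) * z (snd w)) + \<alpha>\<^sup>2 * (F w * (y (fst w) * z (snd w))))"
  define Y' where "Y' = (\<lambda>w. (H (?P w) *v v) \<bullet> v * (y (fst w) * z (snd w)) + \<beta>\<^sup>2 * (F w * (y (fst w) * z (snd w))))"
  define Z where "Z = (\<lambda>w. (\<alpha>\<^sup>2 + \<beta>\<^sup>2 - \<mu>) * (F w * (y (fst w) * z (snd w))))"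
  have cF: "continuous_on (cbox (0, 0) (a, b)) F"
    unfolding F_def by (rule continuous_on_compose_pt[OF robin_data_continuous[OF R]])
  have cg: "continuous_on (cbox (0, 0) (a, b)) (\<lambda>w. g (?P w))"
    by (rule continuous_on_compose_pt) (use R in \<open>simp add: robin_data_def\<close>)
  have cH: "continuous_on (box (0, 0) (a, b)) (\<lambda>w. H (?P w))"
    by (rule continuous_on_compose_pt_interior) (use R in \<open>simp add: robin_data_def\<close>)
  have cHe: "continuous_on (box (0, 0) (a, b)) (\<lambda>w. (H (?P w) *v e) \<bullet> e)" for e
    unfolding matrix_vector_mult_def inner_vec_def
    by (simp add: sum_2) (intro continuous_intros cH)
  have cFi: "continuous_on (box (0, 0) (a, b)) F"
    by (rule continuous_on_subset[OF cF box_subset_cbox])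
  have "integral (cbox (0, 0) (a, b)) Z = 0"
  proof (rule integral_divergence_eq_0[OF a b])
    show "continuous_on (cbox (0, 0) (a, b)) X" "continuous_on (cbox (0, 0) (a, b)) Y"
      "continuous_on (cbox (0, 0) (a, b)) Z"
      unfolding X_def Y_def Z_def by (intro continuous_intros cont cF cg)+
    show "continuous_on (box (0, 0) (a, b)) X'" "continuous_on (box (0, 0) (a, b)) Y'"
      unfolding X'_def Y'_def by (intro continuous_intros cont cFi cHe)+
  next
    fix s t assume st: "0 < s" "s < a" "0 < t" "t < b"
    show "((\<lambda>s. X (s, t)) has_real_derivative X' (s, t)) (at s)"
      unfolding X_def X'_def F_def fst_conv snd_conv
      by (rule derivative_eq_intros d robin_data_D1_interior[OF R st] robin_data_D2[OF R st] refl)+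
        (simp add: algebra_simps)
    show "((\<lambda>t. Y (s, t)) has_real_derivative Y' (s, t)) (at t)"
      unfolding Y_def Y'_def F_def fst_conv snd_conv
      by (rule derivative_eq_intros d w.robin_data_D1_interior[OF R st(3,4,1,2), unfolded pts]
          w.robin_data_D2[OF R st(3,4,1,2), unfolded pts] refl)+
        (simp add: algebra_simps)
    have "- trace (H (pt s t)) = \<mu> * f (pt s t)"
      using R st unfolding robin_data_def by (simp add: pt_mem_rect)
    then have lap: "(H (pt s t) *v u) \<bullet> u + (H (pt s t) *v v) \<bullet> v = - \<mu> * f (pt s t)"
      by (simp add: trace_frame)
    have "X' (s, t) + Y' (s, t) = ((H (pt s t) *v u) \<bullet> u + (H (pt s t) *v v) \<bullet> v +
        (\<alpha>\<^sup>2 + \<beta>\<^sup>2) * f (pt s t)) * (y s * z t)"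
      by (simp add: X'_def Y'_def F_def algebra_simps)
    then show "X' (s, t) + Y' (s, t) = Z (s, t)"
      unfolding lap by (simp add: Z_def F_def algebra_simps)
  next
    fix t assume "0 \<le> t" "t \<le> b"
    then show "X (0, t) = 0 \<and> X (a, t) = 0"
      using robin_data_left[OF R] robin_data_right[OF R] by (simp add: X_def F_def bc)
  next
    fix s assume "0 \<le> s" "s \<le> a"
    then show "Y (s, 0) = 0 \<and> Y (s, b) = 0"
      using w.robin_data_left[OF R, unfolded pts] w.robin_data_right[OF R, unfolded pts]
      by (simp add: Y_def F_def bc)
  qed
  moreover have "Z = (\<lambda>w. (mode2_eigenvalue \<sigma> a b q - \<mu>) * (f (?P w) * mode2 \<sigma> a b q w))"
    by (simp add: Z_def F_def mode2_eigenvalue_def mode2_def \<alpha>_def \<beta>_def y_def z_def)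
  ultimately show ?thesis using assms(3) by simp
qed

text \<open>Subtract from the eigenfunction its projection to the finitely many modes with eigenvalue \<open>\<mu>\<close>. The
  rest is orthogonal to these modes by construction and to all others by Green's identity.\<close>

lemma neumann_eigenspace_subset_span:
  "robin_eigenspace \<Omega> 0 \<mu> \<subseteq> fun_vs.span (rect_mode 0 ` {q. mode2_eigenvalue 0 a b q = \<mu>})"
proof
  fix f assume f: "f \<in> robin_eigenspace \<Omega> 0 \<mu>"
  define I where "I = {q. mode2_eigenvalue 0 a b q = \<mu>}"
  have fin: "finite I"
    by (rule finite_subset[OF _ finite_neumann_eigenvalues_le[OF a b, of \<mu>]]) (auto simp: I_def)
  let ?R = "cbox (0, 0) (a, b)" and ?P = "\<lambda>w. pt (fst w) (snd w)" and ?\<phi> = "mode2 0 a b"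
  obtain g H where R: "robin_data \<Omega> 0 \<mu> f g H" and zero: "\<And>x. x \<notin> closure \<Omega> \<Longrightarrow> f x = 0"
    using f unfolding robin_eigenspace_iff by blast
  have cF: "continuous_on ?R (\<lambda>w. f (?P w))"
    by (rule continuous_on_compose_pt[OF robin_data_continuous[OF R]])
  define c where "c q = integral ?R (\<lambda>w. f (?P w) * ?\<phi> q w) / integral ?R (\<lambda>w. ?\<phi> q w * ?\<phi> q w)" for q
  have W0: "f (?P w) - (\<Sum>q\<in>I. c q * ?\<phi> q w) = 0" if "w \<in> ?R" for w
  proof (rule neumann_modes_complete[OF a b _ _ that])
    show "continuous_on ?R (\<lambda>w. f (?P w) - (\<Sum>q\<in>I. c q * ?\<phi> q w))"
      by (intro continuous_intros cF continuous_on_mode2)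
    fix l
    have "integral ?R (\<lambda>w. (f (?P w) - (\<Sum>q\<in>I. c q * ?\<phi> q w)) * ?\<phi> l w) =
        integral ?R (\<lambda>w. f (?P w) * ?\<phi> l w - (\<Sum>q\<in>I. c q * (?\<phi> q w * ?\<phi> l w)))"
      by (simp add: left_diff_distrib sum_distrib_right mult.assoc)
    also have "\<dots> = integral ?R (\<lambda>w. f (?P w) * ?\<phi> l w) -
        integral ?R (\<lambda>w. \<Sum>q\<in>I. c q * (?\<phi> q w * ?\<phi> l w))"
      by (intro integral_diff integrable_continuous continuous_intros cF continuous_on_mode2)
    also have "integral ?R (\<lambda>w. \<Sum>q\<in>I. c q * (?\<phi> q w * ?\<phi> l w)) =
        (\<Sum>q\<in>I. integral ?R (\<lambda>w. c q * (?\<phi> q w * ?\<phi> l w)))"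
      by (intro integral_sum fin integrable_continuous continuous_intros continuous_on_mode2)
    also have "\<dots> = (\<Sum>q\<in>I. c q * integral ?R (\<lambda>w. ?\<phi> q w * ?\<phi> l w))"
      by simp
    also have "\<dots> = (\<Sum>q\<in>I. if q = l then c l * integral ?R (\<lambda>w. ?\<phi> l w * ?\<phi> l w) else 0)"
      by (rule sum.cong) (use integral_mode2_mult_mode2[OF _ a b, of 0] in auto)
    also have "\<dots> = integral ?R (\<lambda>w. f (?P w) * ?\<phi> l w)"
    proof (cases "l \<in> I")
      case True
      then show ?thesis using fin integral_mode2_sq_neq_0[OF a b, of 0 l] by (simp add: c_def)
    next
      case False
      then show ?thesis
        using fin integral_eigenfunction_mult_mode2[OF _ f, of l] by (simp add: I_def)
    qed
    finally show "integral ?R (\<lambda>w. (f (?P w) - (\<Sum>q\<in>I. c q * ?\<phi> q w)) * ?\<phi> l w) = 0" by simp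
  qed
  have fsum: "(\<Sum>q\<in>I. (\<lambda>x. c q * rect_mode 0 q x)) x = (\<Sum>q\<in>I. c q * rect_mode 0 q x)" for x
    using fin by (induction I) auto
  have "f = (\<Sum>q\<in>I. (\<lambda>x. c q * rect_mode 0 q x))"
  proof
    fix x
    show "f x = (\<Sum>q\<in>I. (\<lambda>x. c q * rect_mode 0 q x)) x"
    proof (cases "x \<in> closure \<Omega>")
      case True
      then have "(cs x, ct x) \<in> ?R" by (simp add: mem_closure)
      from W0[OF this] show ?thesis using True unfolding fsum by (simp add: rect_mode_def)
    next
      case False
      then show ?thesis unfolding fsum by (simp add: zero rect_mode_def)
    qed
  qed
  moreover have "(\<Sum>q\<in>I. (\<lambda>x. c q * rect_mode 0 q x)) \<in> fun_vs.span (rect_mode 0 ` I)"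
    by (intro fun_vs.span_sum fun_vs.span_scale fun_vs.span_base) auto
  ultimately show "f \<in> fun_vs.span (rect_mode 0 ` {q. mode2_eigenvalue 0 a b q = \<mu>})"
    by (simp add: I_def)
qed

section \<open>Comparison of the ordered eigenvalues\<close>

definition counting_levels :: "real \<Rightarrow> nat \<Rightarrow> real set" where
  "counting_levels \<sigma> n = {t. \<exists>B. B \<subseteq> (\<Union>\<mu>\<in>{..t}. robin_eigenspace \<Omega> \<sigma> \<mu>) \<and>
     finite B \<and> fun_vs.independent B \<and> card B = Suc n}"

lemma robin_eigenvalue_eq_Inf: "robin_eigenvalue \<Omega> \<sigma> n = Inf (counting_levels \<sigma> n)"
  by (simp add: robin_eigenvalue_def counting_levels_def)

text \<open>Existence of enough modes bounds the ordered eigenvalue from above, for Robin and Neumann alike.\<close>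

lemma counting_levels_if_modes:
  assumes "\<sigma> \<ge> 0" "finite Q" "Suc n \<le> card Q" "\<And>q. q \<in> Q \<Longrightarrow> mode2_eigenvalue \<sigma> a b q \<le> t"
  shows "t \<in> counting_levels \<sigma> n"
proof -
  let ?P = "\<lambda>z. pt (fst z) (snd z)"
  obtain Q' where Q': "Q' \<subseteq> Q" "card Q' = Suc n" "finite Q'"
    using assms(3) obtain_subset_with_card_n by metis
  have "inj (rect_mode \<sigma>)" by (rule modes_inj[where T = ?P, OF assms(1) a b rect_mode_pt])
  then have "card (rect_mode \<sigma> ` Q') = Suc n" using Q' by (simp add: card_image inj_on_subset)
  moreover have "fun_vs.independent (rect_mode \<sigma> ` Q')"
    by (rule modes_independent[where T = ?P, OF assms(1) a b rect_mode_pt Q'(3)])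
  moreover have "rect_mode \<sigma> ` Q' \<subseteq> (\<Union>\<mu>\<in>{..t}. robin_eigenspace \<Omega> \<sigma> \<mu>)"
    using rect_mode_mem_eigenspace[OF assms(1)] assms(4) Q'(1) by fastforce
  ultimately show ?thesis
    using Q'(3) unfolding counting_levels_def by (intro CollectI exI[of _ "rect_mode \<sigma> ` Q'"]) auto
qed

lemma counting_levels_nonneg:
  assumes "\<sigma> > 0" "t \<in> counting_levels \<sigma> n"
  shows "0 \<le> t"
proof (rule ccontr)
  assume t: "\<not> 0 \<le> t"
  obtain B where B: "B \<subseteq> (\<Union>\<mu>\<in>{..t}. robin_eigenspace \<Omega> \<sigma> \<mu>)" "fun_vs.independent B" "card B = Suc n"
    using assms(2) unfolding counting_levels_def by blast
  obtain f where f: "f \<in> B" using B(3) by (metis card.empty equals0I nat.distinct(1))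
  then obtain \<mu> where "\<mu> \<le> t" "f \<in> robin_eigenspace \<Omega> \<sigma> \<mu>" using B(1) by auto
  moreover from this(1) t have "\<mu> < 0" by simp
  ultimately have "f = 0" using robin_eigenfunction_negative_eq_0[OF assms(1)] by simp
  then show False using f B(2) fun_vs.dependent_zero by blast
qed

text \<open>Conversely, by completeness, independent Neumann eigenfunctions cannot outnumber the modes.\<close>

lemma card_neumann_modes:
  assumes "t \<in> counting_levels 0 n"
  shows "Suc n \<le> card {q. mode2_eigenvalue 0 a b q \<le> t}"
proof -
  let ?Q = "{q. mode2_eigenvalue 0 a b q \<le> t}"
  have fin: "finite ?Q" by (rule finite_neumann_eigenvalues_le[OF a b])
  obtain B where B: "B \<subseteq> (\<Union>\<mu>\<in>{..t}. robin_eigenspace \<Omega> 0 \<mu>)" "fun_vs.independent B" "card B = Suc n"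
    using assms unfolding counting_levels_def by blast
  have "B \<subseteq> fun_vs.span (rect_mode 0 ` ?Q)"
  proof
    fix f assume "f \<in> B"
    then obtain \<mu> where \<mu>: "\<mu> \<le> t" "f \<in> robin_eigenspace \<Omega> 0 \<mu>" using B(1) by auto
    then have "f \<in> fun_vs.span (rect_mode 0 ` {q. mode2_eigenvalue 0 a b q = \<mu>})"
      using neumann_eigenspace_subset_span by blast
    moreover have "rect_mode 0 ` {q. mode2_eigenvalue 0 a b q = \<mu>} \<subseteq> rect_mode 0 ` ?Q" using \<mu>(1) by auto
    ultimately show "f \<in> fun_vs.span (rect_mode 0 ` ?Q)" using fun_vs.span_mono by blast
  qed
  then have "card B \<le> card (rect_mode 0 ` ?Q)"
    using fun_vs.independent_span_bound[OF _ B(2)] fin by blast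
  also have "\<dots> \<le> card ?Q" by (rule card_image_le[OF fin])
  finally show ?thesis using B(3) by simp
qed

text \<open>Adding \<open>C\<close> maps the levels of the Neumann problem into those of the Robin problem. Non-emptiness
  of the former and boundedness of the latter make this an inequality between the infima.\<close>

lemma robin_neumann_gap_le:
  assumes "\<sigma> > 0"
  shows "robin_neumann_gap \<Omega> n \<sigma> \<le> 4 * \<sigma> / a + 4 * \<sigma> / b" (is "_ \<le> ?C")
proof -
  have bdd: "bdd_below (counting_levels \<sigma> n)"
    using counting_levels_nonneg[OF assms] by (rule bdd_belowI)
  have "Inf (counting_levels \<sigma> n) - ?C \<le> Inf (counting_levels 0 n)"
  proof (rule cInf_greatest)
    have "Max (mode2_eigenvalue 0 a b ` ({..n} \<times> {0})) \<in> counting_levels 0 n"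
      by (rule counting_levels_if_modes[of _ "{..n} \<times> {0}"]) auto
    then show "counting_levels 0 n \<noteq> {}" by blast
    fix t assume "t \<in> counting_levels 0 n"
    have "t + ?C \<in> counting_levels \<sigma> n"
    proof (rule counting_levels_if_modes)
      show "finite {q. mode2_eigenvalue 0 a b q \<le> t}"
        by (rule finite_neumann_eigenvalues_le[OF a b])
      show "Suc n \<le> card {q. mode2_eigenvalue 0 a b q \<le> t}"
        by (rule card_neumann_modes) fact
      fix q assume "q \<in> {q. mode2_eigenvalue 0 a b q \<le> t}"
      then show "mode2_eigenvalue \<sigma> a b q \<le> t + ?C"
        using mode2_eigenvalue_le[OF _ a b, of \<sigma> q] assms by simp
    qed (use assms in simp)
    then have "Inf (counting_levels \<sigma> n) \<le> t + ?C" using bdd by (rule cInf_lower)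
    then show "Inf (counting_levels \<sigma> n) - ?C \<le> t" by simp
  qed
  then show ?thesis
    by (simp add: robin_neumann_gap_def robin_eigenvalue_eq_Inf)
qed

end

theorem theorem1p7:
  fixes \<Omega> :: "(real^2) set"
  assumes "rectangle \<Omega>"
  shows "\<forall>\<sigma>>0. \<exists>C>0. \<forall>n. robin_neumann_gap \<Omega> n \<sigma> \<le> C"
proof (intro allI impI)
  fix \<sigma> :: real assume \<sigma>: "\<sigma> > 0"
  obtain p u v a b where *: "norm u = 1" "norm v = 1" "u \<bullet> v = 0" "a > 0" "b > 0"
    "\<Omega> = {p + s *\<^sub>R u + t *\<^sub>R v | s t. 0 < s \<and> s < a \<and> 0 < t \<and> t < b}"
    using assms unfolding rectangle_def by blast
  interpret rectangle_frame p u v a b \<Omega> by unfold_locales (rule *)+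
  have "4 * \<sigma> / a + 4 * \<sigma> / b > 0" using * \<sigma> by (simp add: add_pos_pos)
  then show "\<exists>C>0. \<forall>n. robin_neumann_gap \<Omega> n \<sigma> \<le> C" using robin_neumann_gap_le[OF \<sigma>] by blast
qed

end
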